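(* Suppose that $\{x\in\mathbb{R}^n:Ax=b\}$ is nonempty and that $f:\mathbb{R}^n\to\mathbb{R}$ is proper, lower semicontinuous and $\rho$-weakly convex ($\rho>0$). Let $\gamma\in(0,\rho^{-1})$ and $\eta\in(0,2)$, and let $\{(x^k,z^k,\lambda^k)\}$ be a sequence generated by iMEAL (defined in the context) with $\sum_{k=0}^\infty\epsilon_k^2<\infty$. Then the following hold. (a) Use a fixed penalty parameter $\beta_k=\beta$ for all $k$, with $\beta$ sufficiently large such that $$\alpha:=\frac{2\beta+\gamma\eta(1-\eta/2)}{2c_{\gamma,A}\beta^2}<\min\left\{\frac{1-\gamma\rho}{6\gamma(1+\gamma L_f)^2},\ \frac{1}{12\gamma}\Big(\frac{2}{\eta}-1\Big)\right\}.$$ If $f$ satisfies the implicit Lipschitz subgradient property with constant $L_f>0$ (possibly depending on $\gamma$) and $\{\mathcal{E}^k_{\mathrm{imeal}}\}_{k\ge1}$ is lower bounded, then $\xi^k_{\mathrm{meal}}=o(1/\sqrt{k})$. (b) Pick $K\ge1$. Set $\{\beta_k\}$ such that $\alpha_k\equiv\frac{\hat\alpha^*}{K}$ for some positive constant $\hat\alpha^*\le\min\left\{\frac{1-\rho\gamma}{8\gamma},\ \frac{1}{16\gamma}\big(\frac{2}{\eta}-1\big)\right\}$. If $f$ satisfies the implicit bounded subgradient property with constant $\hat L_f>0$ (possibly depending on $\gamma$) and $\{\tilde{\mathcal{E}}^k_{\mathrm{imeal}}\}_{k\ge1}$ is lower bounded, then $\xi^K_{\mathrm{meal}}\le\tilde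 c_2/\sqrt{K}$ for some constant $\tilde c_2>0$.
   Context: The problem is to minimize $f(x)$ over $x\in\mathbb{R}^n$ subject to $Ax=b$, with $A\in\mathbb{R}^{m\times n}$, $b\in\mathbb{R}^m$. $\|\cdot\|$ is the Euclidean norm. A function $h$ is $\rho$-weakly convex ($\rho>0$) if $h+\frac{\rho}{2}\|\cdot\|^2$ is convex. $\partial$ denotes the limiting subdifferential. Moreau envelope and prox: $\mathcal{M}_{\gamma,h}(z)=\min_x\{h(x)+\frac1{2\gamma}\|x-z\|^2\}$, $\mathrm{Prox}_{\gamma,h}(z)=\operatorname{argmin}_x\{h(x)+\frac1{2\gamma}\|x-z\|^2\}$. If $h$ is proper, lower semicontinuous, $\rho$-weakly convex and $\gamma\in(0,\rho^{-1})$, the prox is single-valued and $\mathcal{M}_{\gamma,h}$ is differentiable with $\nabla\mathcal{M}_{\gamma,h}(z)=\gamma^{-1}(z-\mathrm{Prox}_{\gamma,h}(z))$. For $x\in\mathrm{ran}(\mathrm{Prox}_{\gamma,h})$ let $\mathrm{Prox}_{\gamma,h}^{-1}(x)=\{w:\mathrm{Prox}_{\gamma,h}(w)=x\}$. Implicit Lipschitz subgradient property of $h$: for any $\gamma\in(0,\rho^{-1})$ there is $L>0$ (depending on $\gamma$) such that for all $u,v\in\mathrm{ran}(\mathrm{Prox}_{\gamma,h})$, all $w\in\mathrm{Prox}_{\gamma,h}^{-1}(u)$ and $w'\in\mathrm{Prox}_{\gamma,h}^{-1}(v)$: $\|\nabla\mathcal{M}_{\gamma,h}(w)-\nabla\mathcal{M}_{\gamma,h}(w')\|\le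 L\|u-v\|$. Implicit bounded subgradient property of $h$: for any $\gamma\in(0,\rho^{-1})$ there is $\hat L>0$ (depending on $\gamma$) such that for all $u\in\mathrm{ran}(\mathrm{Prox}_{\gamma,h})$ and $w\in\mathrm{Prox}_{\gamma,h}^{-1}(u)$: $\|\nabla\mathcal{M}_{\gamma,h}(w)\|\le\hat L$. For $\beta>0$: $\mathcal{L}_\beta(x,\lambda)=f(x)+\langle\lambda,Ax-b\rangle+\frac\beta2\|Ax-b\|^2$, $\phi_\beta(z,\lambda)=\min_x\{\mathcal{L}_\beta(x,\lambda)+\frac1{2\gamma}\|x-z\|^2\}$, $\mathcal{P}_\beta(x,z,\lambda)=\mathcal{L}_\beta(x,\lambda)+\frac1{2\gamma}\|x-z\|^2$. iMEAL: given $(z^0,\lambda^0)$, $\gamma>0$, $\eta\in(0,2)$ and positive sequences $\{\epsilon_k\},\{\beta_k\}$, for $k=0,1,\dots$: find $x^{k+1}$ for which there exists $s^k\in\partial_x\mathcal{L}_{\beta_k}(x^{k+1},\lambda^k)+\gamma^{-1}(x^{k+1}-z^k)$ with $\|s^k\|\le\epsilon_k$; then $z^{k+1}=z^k-\eta(z^k-x^{k+1})$, $\lambda^{k+1}=\lambda^k+\beta_k(Ax^{k+1}-b)$. Stationarity measure: $\xi^k_{\mathrm{meal}}=\min_{0\le t\le k}\|\nabla\phi_{\beta_t}(z^t,\lambda^t)\|$, the gradient being with respect to $(z,\lambda)$. Let $c_{\gamma,A}=\gamma^2\tilde\sigma_{\min}(A^TA)$, where $\tilde\sigma_{\min}(A^TA)$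 is the smallest positive eigenvalue of $A^TA$, and $\alpha_k=\frac{\beta_k+\beta_{k+1}+\gamma\eta(1-\eta/2)}{2c_{\gamma,A}\beta_k^2}$ (so $\alpha_k=\alpha$ when $\beta_k\equiv\beta$). For $k\ge1$: $\mathcal{E}^k_{\mathrm{imeal}}=\mathcal{P}_{\beta_k}(x^k,z^k,\lambda^k)+3\alpha_k\|z^k-z^{k-1}\|^2$, and $\tilde{\mathcal{E}}^k_{\mathrm{imeal}}=\mathcal{P}_{\beta_k}(x^k,z^k,\lambda^k)+4\alpha_k\|z^k-z^{k-1}\|^2$. *)

theory Defs
  imports "HOL-Analysis.Analysis" "HOL-Library.Landau_Symbols"
begin

definition lower_semicontinuous :: "('a::topological_space \<Rightarrow> real) \<Rightarrow> bool" where
  "lower_semicontinuous h \<longleftrightarrow> (\<forall>x. ereal (h x) \<le> Liminf (at x) (\<lambda>y. ereal (h y)))"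

definition weakly_convex :: "real \<Rightarrow> ('a::real_normed_vector \<Rightarrow> real) \<Rightarrow> bool" where
  "weakly_convex \<rho> h \<longleftrightarrow> convex_on UNIV (\<lambda>x. h x + \<rho> / 2 * (norm x)\<^sup>2)"

(* Meaningful only where h is differentiable. *)
definition gradient :: "('a::real_inner \<Rightarrow> real) \<Rightarrow> 'a \<Rightarrow> 'a" where
  "gradient h x = (THE D. GDERIV h x :> D)"

definition regular_subdifferential :: "('a::real_inner \<Rightarrow> real) \<Rightarrow> 'a \<Rightarrow> 'a set" where
  "regular_subdifferential h x =
     {v. 0 \<le> Liminf (at x) (\<lambda>y. ereal ((h y - h x - v \<bullet> (y - x)) / norm (y - x)))}"

(* The Mordukhovich subdifferential: limits of regular subgradients along h-attentive sequences. *)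
definition limiting_subdifferential :: "('a::real_inner \<Rightarrow> real) \<Rightarrow> 'a \<Rightarrow> 'a set" where
  "limiting_subdifferential h x =
     {v. \<exists>X V. X \<longlonglongrightarrow> x \<and> (\<lambda>n. h (X n)) \<longlonglongrightarrow> h x \<and>
           (\<forall>n::nat. V n \<in> regular_subdifferential h (X n)) \<and> V \<longlonglongrightarrow> v}"

definition moreau :: "real \<Rightarrow> ('a::real_normed_vector \<Rightarrow> real) \<Rightarrow> 'a \<Rightarrow> real" where
  "moreau \<gamma> h z = (INF x. h x + 1 / (2 * \<gamma>) * (norm (x - z))\<^sup>2)"

(* Single-valued: used only for lower semicontinuous \<rho>-weakly convex h and 0 < \<gamma> < 1 / \<rho>,
   where the minimizer exists and is unique. *)
definition prox :: "real \<Rightarrow> ('a::real_normed_vector \<Rightarrow> real) \<Rightarrow> 'a \<Rightarrow> 'a" where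
  "prox \<gamma> h z = (ARG_MIN (\<lambda>x. h x + 1 / (2 * \<gamma>) * (norm (x - z))\<^sup>2) x. True)"

(* The constant is a function of \<gamma>: the property is required for every \<gamma> in (0, 1 / \<rho>),
   with L \<gamma> the corresponding constant. *)
definition implicit_lipschitz_subgradient ::
    "real \<Rightarrow> ('a::real_inner \<Rightarrow> real) \<Rightarrow> (real \<Rightarrow> real) \<Rightarrow> bool" where
  "implicit_lipschitz_subgradient \<rho> h L \<longleftrightarrow>
     (\<forall>\<gamma>. 0 < \<gamma> \<and> \<gamma> < inverse \<rho> \<longrightarrow>
        0 < L \<gamma> \<and>
        (\<forall>u \<in> range (prox \<gamma> h). \<forall>v \<in> range (prox \<gamma> h).
         \<forall>w \<in> prox \<gamma> h -` {u}. \<forall>w' \<in> prox \<gamma> h -` {v}.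
           norm (gradient (moreau \<gamma> h) w - gradient (moreau \<gamma> h) w') \<le> L \<gamma> * norm (u - v)))"

definition implicit_bounded_subgradient ::
    "real \<Rightarrow> ('a::real_inner \<Rightarrow> real) \<Rightarrow> (real \<Rightarrow> real) \<Rightarrow> bool" where
  "implicit_bounded_subgradient \<rho> h L \<longleftrightarrow>
     (\<forall>\<gamma>. 0 < \<gamma> \<and> \<gamma> < inverse \<rho> \<longrightarrow>
        0 < L \<gamma> \<and>
        (\<forall>u \<in> range (prox \<gamma> h). \<forall>w \<in> prox \<gamma> h -` {u}.
           norm (gradient (moreau \<gamma> h) w) \<le> L \<gamma>))"

definition aug_lagrangian ::
    "(real^'n \<Rightarrow> real) \<Rightarrow> real^'n^'m \<Rightarrow> real^'m \<Rightarrow> real \<Rightarrow> real^'n \<Rightarrow> real^'m \<Rightarrow> real" where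
  "aug_lagrangian f A b \<beta> x lam =
     f x + lam \<bullet> (A *v x - b) + \<beta> / 2 * (norm (A *v x - b))\<^sup>2"

definition prox_lagrangian ::
    "(real^'n \<Rightarrow> real) \<Rightarrow> real^'n^'m \<Rightarrow> real^'m \<Rightarrow> real \<Rightarrow> real \<Rightarrow>
     real^'n \<Rightarrow> real^'n \<Rightarrow> real^'m \<Rightarrow> real" where
  "prox_lagrangian f A b \<gamma> \<beta> x z lam =
     aug_lagrangian f A b \<beta> x lam + 1 / (2 * \<gamma>) * (norm (x - z))\<^sup>2"

(* A function of the pair (z, lam), so that its gradient is the joint one. *)
definition meal_envelope ::
    "(real^'n \<Rightarrow> real) \<Rightarrow> real^'n^'m \<Rightarrow> real^'m \<Rightarrow> real \<Rightarrow> real \<Rightarrow> (real^'n) \<times> (real^'m) \<Rightarrow> real" where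
  "meal_envelope f A b \<gamma> \<beta> = (\<lambda>(z, lam). INF x. prox_lagrangian f A b \<gamma> \<beta> x z lam)"

(* x 0 plays no role: the algorithm starts from (z 0, lam 0) and first computes x 1. *)
definition imeal ::
    "(real^'n \<Rightarrow> real) \<Rightarrow> real^'n^'m \<Rightarrow> real^'m \<Rightarrow> real \<Rightarrow> real \<Rightarrow> (nat \<Rightarrow> real) \<Rightarrow> (nat \<Rightarrow> real) \<Rightarrow>
     (nat \<Rightarrow> real^'n) \<Rightarrow> (nat \<Rightarrow> real^'n) \<Rightarrow> (nat \<Rightarrow> real^'m) \<Rightarrow> bool" where
  "imeal f A b \<gamma> \<eta> eps \<beta> x z lam \<longleftrightarrow>
     (\<forall>k. (\<exists>s \<in> (\<lambda>g. g + (1 / \<gamma>) *\<^sub>R (x (Suc k) - z k)) `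
                 limiting_subdifferential (\<lambda>y. aug_lagrangian f A b (\<beta> k) y (lam k)) (x (Suc k)).
             norm s \<le> eps k) \<and>
          z (Suc k) = z k - \<eta> *\<^sub>R (z k - x (Suc k)) \<and>
          lam (Suc k) = lam k + \<beta> k *\<^sub>R (A *v x (Suc k) - b))"

definition meal_measure ::
    "(real^'n \<Rightarrow> real) \<Rightarrow> real^'n^'m \<Rightarrow> real^'m \<Rightarrow> real \<Rightarrow> (nat \<Rightarrow> real) \<Rightarrow>
     (nat \<Rightarrow> real^'n) \<Rightarrow> (nat \<Rightarrow> real^'m) \<Rightarrow> nat \<Rightarrow> real" where
  "meal_measure f A b \<gamma> \<beta> z lam k =
     Min ((\<lambda>t. norm (gradient (meal_envelope f A b \<gamma> (\<beta> t)) (z t, lam t))) ` {0..k})"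

definition eigenvalue :: "real^'n^'n \<Rightarrow> real \<Rightarrow> bool" where
  "eigenvalue M \<mu> \<longleftrightarrow> (\<exists>v. v \<noteq> 0 \<and> M *v v = \<mu> *\<^sub>R v)"

(* Unspecified if there is no positive eigenvalue; for M = transpose A ** A this happens
   only when A = 0. *)
definition min_pos_eigenvalue :: "real^'n^'n \<Rightarrow> real" where
  "min_pos_eigenvalue M = (LEAST \<mu>. 0 < \<mu> \<and> eigenvalue M \<mu>)"

definition c_const :: "real \<Rightarrow> real^'n^'m \<Rightarrow> real" where
  "c_const \<gamma> A = \<gamma>\<^sup>2 * min_pos_eigenvalue (transpose A ** A)"

definition imeal_alpha :: "real \<Rightarrow> real \<Rightarrow> real^'n^'m \<Rightarrow> (nat \<Rightarrow> real) \<Rightarrow> nat \<Rightarrow> real" where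
  "imeal_alpha \<gamma> \<eta> A \<beta> k =
     (\<beta> k + \<beta> (Suc k) + \<gamma> * \<eta> * (1 - \<eta> / 2)) / (2 * c_const \<gamma> A * (\<beta> k)\<^sup>2)"

(* Lyapunov functions, with weight \<theta> = 3 or 4; only used for k \<ge> 1. *)
definition imeal_energy ::
    "real \<Rightarrow> (real^'n \<Rightarrow> real) \<Rightarrow> real^'n^'m \<Rightarrow> real^'m \<Rightarrow> real \<Rightarrow> real \<Rightarrow> (nat \<Rightarrow> real) \<Rightarrow>
     (nat \<Rightarrow> real^'n) \<Rightarrow> (nat \<Rightarrow> real^'n) \<Rightarrow> (nat \<Rightarrow> real^'m) \<Rightarrow> nat \<Rightarrow> real" where
  "imeal_energy \<theta> f A b \<gamma> \<eta> \<beta> x z lam k =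
     prox_lagrangian f A b \<gamma> (\<beta> k) (x k) (z k) (lam k)
       + \<theta> * imeal_alpha \<gamma> \<eta> A \<beta> k * (norm (z k - z (k - 1)))\<^sup>2"

end

theory Submission
  imports Defs
begin

text \<open>
  Write \<open>\<mu> = 1 / \<gamma> - \<rho> > 0\<close>. All the analysis rests on one observation: a limiting subgradient \<open>v\<close> of a
  \<open>\<rho>\<close>-weakly convex function \<open>h\<close> at \<open>x\<close> gives the global minorant
  \<open>h y \<ge> h x + v \<bullet> (y - x) - \<rho> / 2 * |y - x|^2\<close>
  (\<open>limiting_subdifferential_weak_subgradient\<close>). Hence the inexact stationarity of
  \<open>x (k + 1)\<close> for the proximal augmented Lagrangian, which is \<open>\<mu>\<close>-strongly convex in \<open>x\<close>, makes
  that function drop by \<open>\<mu> / 2 * |x (k + 1) - x k|^2\<close> up to an error controlled by \<open>eps k\<close>. The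
  relaxation step for \<open>z\<close> drops it further, and only the updates of the multiplier and of the penalty
  parameter can raise it, by a multiple of \<open>|lam (k + 1) - lam k|^2\<close> (\<open>descent\<close>).

  The multiplier increment is controlled through the dual equation
  \<open>A^T lam (k + 1) = s k + (z k - x (k + 1)) / \<gamma> - w k\<close>, where \<open>w k\<close> is a subgradient of \<open>f\<close> at
  \<open>x (k + 1)\<close>. The increment lies in the range of \<open>A\<close>, where \<open>A^T\<close> is bounded below by the smallest
  positive eigenvalue of \<open>A^T A\<close> (\<open>min_pos_eigenvalue_gram\<close>), so it suffices to bound \<open>w k - w (k - 1)\<close>.
  Since \<open>x (k + 1)\<close> is the proximal point of \<open>x (k + 1) + \<gamma> * w k\<close>, and \<open>w k\<close> is the gradient of
  the Moreau envelope there (\<open>prox_and_moreau_gradient\<close>), the two implicit subgradient properties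
  bound precisely this difference: by \<open>L * |x (k + 1) - x k|\<close> in the first part and by \<open>2 * L\<close> in
  the second. The part of the increment coming from \<open>z k - z (k - 1)\<close> belongs to the previous
  step, and is the reason for the additional term in the energy.

  Finally, the gradient of the envelope at \<open>(z k, lam k)\<close> is \<open>((z k - y) / \<gamma>, A y - b)\<close> with \<open>y\<close> the
  exact minimizer, by Danskin's argument (\<open>envelope_theorem\<close>), and \<open>y\<close> is within
  \<open>2 * eps k / \<mu>\<close> of \<open>x (k + 1)\<close>. So its squared norm is bounded by the energy decrease plus a multiple
  of \<open>(eps k)^2\<close>. In the first part the decreases are summable, and the running minimum of a
  square-summable sequence is \<open>o(1 / sqrt k)\<close>. In the second part every step pays an extra term of
  order \<open>1 / K\<close>, hence a bounded amount in \<open>K\<close> steps. The remaining point there is uniformity: the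
  penalty parameters may be arbitrarily large, so the energy after the first step has to be
  bounded independently of them (\<open>first_iterate_bound\<close>, \<open>initial_energy_bound\<close>).
\<close>

section \<open>Weak convexity and global subgradient inequalities\<close>

lemma norm_sq_segment:
  fixes x d :: "'a::real_inner"
  shows "(norm (x + t *\<^sub>R d))\<^sup>2
    = (1 - t) * (norm x)\<^sup>2 + t * (norm (x + d))\<^sup>2 - t * (1 - t) * (norm d)\<^sup>2"
  by (simp only: power2_norm_eq_inner) (simp add: inner_commute algebra_simps)

text \<open>
  Unlike the definition, which adds a quadratic centred at the origin, this form is translation
  invariant: only the direction \<open>d\<close> of the segment occurs. It makes moduli of composite functions
  computable term by term.
\<close>

lemma weakly_convex_segment:
  fixes h :: "'a::real_inner \<Rightarrow> real"
  assumes "weakly_convex \<rho> h" "0 \<le> t" "t \<le> 1"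
  shows "h (x + t *\<^sub>R d) \<le> (1 - t) * h x + t * h (x + d) + \<rho> / 2 * (t * (1 - t) * (norm d)\<^sup>2)"
proof -
  have eq: "(1 - t) *\<^sub>R x + t *\<^sub>R (x + d) = x + t *\<^sub>R d"
    by (simp add: algebra_simps)
  have "h (x + t *\<^sub>R d) + \<rho> / 2 * (norm (x + t *\<^sub>R d))\<^sup>2
      \<le> (1 - t) * (h x + \<rho> / 2 * (norm x)\<^sup>2) + t * (h (x + d) + \<rho> / 2 * (norm (x + d))\<^sup>2)"
    using convex_onD[OF assms(1)[unfolded weakly_convex_def] assms(2,3), of x "x + d"]
    unfolding eq by simp
  then show ?thesis
    unfolding norm_sq_segment by (simp add: algebra_simps add_divide_distrib diff_divide_distrib)
qed

lemma weakly_convexI_segment: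
  fixes h :: "'a::real_inner \<Rightarrow> real"
  assumes "\<And>x d t. 0 < t \<Longrightarrow> t < 1 \<Longrightarrow>
    h (x + t *\<^sub>R d) \<le> (1 - t) * h x + t * h (x + d) + \<rho> / 2 * (t * (1 - t) * (norm d)\<^sup>2)"
  shows "weakly_convex \<rho> h"
  unfolding weakly_convex_def
proof (rule convex_onI)
  fix t :: real and x y :: 'a
  assume t: "0 < t" "t < 1"
  have eq: "(1 - t) *\<^sub>R x + t *\<^sub>R y = x + t *\<^sub>R (y - x)"
    by (simp add: algebra_simps)
  have sq: "(norm (x + t *\<^sub>R (y - x)))\<^sup>2
      = (1 - t) * (norm x)\<^sup>2 + t * (norm y)\<^sup>2 - t * (1 - t) * (norm (y - x))\<^sup>2"
    using norm_sq_segment[of x t "y - x"] by simp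
  show "h ((1 - t) *\<^sub>R x + t *\<^sub>R y) + \<rho> / 2 * (norm ((1 - t) *\<^sub>R x + t *\<^sub>R y))\<^sup>2
      \<le> (1 - t) * (h x + \<rho> / 2 * (norm x)\<^sup>2) + t * (h y + \<rho> / 2 * (norm y)\<^sup>2)"
    using assms[OF t, of x "y - x"]
    unfolding eq sq by (simp add: algebra_simps add_divide_distrib diff_divide_distrib)
qed simp

lemma weakly_convex_add:
  assumes "weakly_convex \<rho> g" "weakly_convex \<sigma> h"
  shows "weakly_convex (\<rho> + \<sigma>) (\<lambda>x. g x + h x)"
proof -
  have "(\<lambda>x. (g x + \<rho> / 2 * (norm x)\<^sup>2) + (h x + \<sigma> / 2 * (norm x)\<^sup>2))
      = (\<lambda>x. g x + h x + (\<rho> + \<sigma>) / 2 * (norm x)\<^sup>2)"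
    by (auto simp: algebra_simps add_divide_distrib)
  then show ?thesis
    using convex_on_add[OF assms[unfolded weakly_convex_def]] by (simp add: weakly_convex_def)
qed

lemma weakly_convex_quadratic_affine:
  fixes A :: "real^'n^'m"
  assumes "0 \<le> \<beta>"
  shows "weakly_convex 0 (\<lambda>x. lam \<bullet> (A *v x - b) + \<beta> / 2 * (norm (A *v x - b))\<^sup>2)"
proof (rule weakly_convexI_segment)
  fix x d :: "real^'n" and t :: real
  assume t: "0 < t" "t < 1"
  let ?r = "A *v x - b"
  have r: "A *v (x + t *\<^sub>R d) - b = ?r + t *\<^sub>R (A *v d)" "A *v (x + d) - b = ?r + A *v d"
    by (simp_all add: algebra_simps)
  have "0 \<le> \<beta> / 2 * (t * (1 - t) * (norm (A *v d))\<^sup>2)"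
    using t assms by simp
  then show "lam \<bullet> (A *v (x + t *\<^sub>R d) - b) + \<beta> / 2 * (norm (A *v (x + t *\<^sub>R d) - b))\<^sup>2
    \<le> (1 - t) * (lam \<bullet> ?r + \<beta> / 2 * (norm ?r)\<^sup>2)
      + t * (lam \<bullet> (A *v (x + d) - b) + \<beta> / 2 * (norm (A *v (x + d) - b))\<^sup>2)
      + 0 / 2 * (t * (1 - t) * (norm d)\<^sup>2)"
    unfolding r norm_sq_segment by (simp add: inner_add_right algebra_simps add_divide_distrib diff_divide_distrib)
qed

text \<open>
  A negative modulus expresses strong convexity, so that adding a proximal term simply adds moduli.
\<close>

lemma weakly_convex_proximal_term:
  fixes z :: "'a::real_inner"
  shows "weakly_convex (- c) (\<lambda>x. c / 2 * (norm (x - z))\<^sup>2)"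
proof (rule weakly_convexI_segment)
  fix x d :: 'a and t :: real
  have eq: "x + t *\<^sub>R d - z = (x - z) + t *\<^sub>R d" "x + d - z = (x - z) + d"
    by auto
  show "c / 2 * (norm (x + t *\<^sub>R d - z))\<^sup>2 \<le> (1 - t) * (c / 2 * (norm (x - z))\<^sup>2)
     + t * (c / 2 * (norm (x + d - z))\<^sup>2) + - c / 2 * (t * (1 - t) * (norm d)\<^sup>2)"
    unfolding eq norm_sq_segment by (simp add: algebra_simps diff_divide_distrib)
qed

text \<open>
  The linear minorant at \<open>x\<close> with slope \<open>v\<close>, corrected by a global quadratic. Modulus \<open>0\<close> is
  the subgradient of convex analysis, and \<open>v = 0\<close> then says that \<open>x\<close> is a global minimizer; a
  negative modulus expresses quadratic growth.
\<close>

definition weak_subgradient :: "real \<Rightarrow> ('a::real_inner \<Rightarrow> real) \<Rightarrow> 'a \<Rightarrow> 'a \<Rightarrow> bool" where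
  "weak_subgradient \<rho> h x v \<longleftrightarrow> (\<forall>y. h y \<ge> h x + v \<bullet> (y - x) - \<rho> / 2 * (norm (y - x))\<^sup>2)"

lemma weak_subgradientD:
  "weak_subgradient \<rho> h x v \<Longrightarrow> h x + v \<bullet> (y - x) - \<rho> / 2 * (norm (y - x))\<^sup>2 \<le> h y"
  by (simp add: weak_subgradient_def)

lemma weak_subgradient_add:
  assumes "weak_subgradient \<rho> g x v" "weak_subgradient \<sigma> h x w"
  shows "weak_subgradient (\<rho> + \<sigma>) (\<lambda>y. g y + h y) x (v + w)"
  unfolding weak_subgradient_def
proof
  fix y
  show "g y + h y \<ge> g x + h x + (v + w) \<bullet> (y - x) - (\<rho> + \<sigma>) / 2 * (norm (y - x))\<^sup>2"
    using weak_subgradientD[OF assms(1), of y] weak_subgradientD[OF assms(2), of y]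
    by (simp add: inner_add_left add_divide_distrib distrib_right)
qed

lemma weak_subgradient_proximal_term:
  fixes z :: "'a::real_inner"
  shows "weak_subgradient (- c) (\<lambda>x. c / 2 * (norm (x - z))\<^sup>2) x (c *\<^sub>R (x - z))"
  unfolding weak_subgradient_def
proof
  fix y
  have "(norm (y - z))\<^sup>2 = (norm (x - z))\<^sup>2 + 2 * ((x - z) \<bullet> (y - x)) + (norm (y - x))\<^sup>2"
    by (simp only: power2_norm_eq_inner) (simp add: inner_commute algebra_simps)
  then show "c / 2 * (norm (y - z))\<^sup>2
      \<ge> c / 2 * (norm (x - z))\<^sup>2 + c *\<^sub>R (x - z) \<bullet> (y - x) - - c / 2 * (norm (y - x))\<^sup>2"
    by (simp add: distrib_left)
qed

text \<open>
  Weak convexity bounds \<open>h\<close> at \<open>x + t d\<close> from above by its values at \<open>x\<close> and \<open>x + d\<close>. Comparing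
  this with a first-order lower bound at \<open>x + t d\<close>, dividing by \<open>t\<close> and letting \<open>t\<close> tend to \<open>0\<close>
  turns local first-order information at \<open>x\<close> into a bound at the far end of the segment.
\<close>

lemma weak_subgradient_of_directional:
  fixes h :: "'a::real_inner \<Rightarrow> real"
  assumes wc: "weakly_convex \<rho> h"
    and dir: "\<And>d e. 0 < e \<Longrightarrow> \<forall>\<^sub>F t in at_right 0. h x + t * (v \<bullet> d) - e * t \<le> h (x + t *\<^sub>R d)"
  shows "weak_subgradient \<rho> h x v"
  unfolding weak_subgradient_def
proof
  fix y
  define d where "d = y - x"
  have y: "y = x + d" by (simp add: d_def)
  have "v \<bullet> d \<le> (h y - h x + \<rho> / 2 * (norm d)\<^sup>2) + e" if e: "0 < e" for e :: real
  proof (rule tendsto_lowerbound)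
    show "((\<lambda>t::real. h y - h x + \<rho> / 2 * ((1 - t) * (norm d)\<^sup>2) + e)
        \<longlongrightarrow> (h y - h x + \<rho> / 2 * (norm d)\<^sup>2) + e) (at_right 0)"
      by (auto intro!: tendsto_eq_intros)
    have small: "\<forall>\<^sub>F t::real in at_right 0. 0 < t \<and> t < 1"
      unfolding eventually_at_right_field by (rule exI[of _ 1]) auto
    show "\<forall>\<^sub>F t in at_right 0. v \<bullet> d \<le> h y - h x + \<rho> / 2 * ((1 - t) * (norm d)\<^sup>2) + e"
      using small dir[OF e, of d]
    proof eventually_elim
      fix t :: real
      assume t: "0 < t \<and> t < 1" and "h x + t * (v \<bullet> d) - e * t \<le> h (x + t *\<^sub>R d)"
      then have "t * (v \<bullet> d) \<le> t * (h y - h x + \<rho> / 2 * ((1 - t) * (norm d)\<^sup>2) + e)"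
        using weakly_convex_segment[OF wc, of t x d] by (simp add: y algebra_simps)
      then show "v \<bullet> d \<le> h y - h x + \<rho> / 2 * ((1 - t) * (norm d)\<^sup>2) + e"
        using t by simp
    qed
  qed simp
  then show "h y \<ge> h x + v \<bullet> (y - x) - \<rho> / 2 * (norm (y - x))\<^sup>2"
    using field_le_epsilon[of "v \<bullet> d" "h y - h x + \<rho> / 2 * (norm d)\<^sup>2"] by (simp add: d_def)
qed

text \<open>
  The quadratic correction of a minorant is of order \<open>t^2\<close> along rays, hence invisible to first
  order: whatever modulus the minorant was found with, the modulus of \<open>h\<close> itself will do.
\<close>

lemma weak_subgradient_sharpen:
  fixes h :: "'a::real_inner \<Rightarrow> real"
  assumes wc: "weakly_convex \<rho> h" and sub: "weak_subgradient \<sigma> h x v"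
  shows "weak_subgradient \<rho> h x v"
proof (rule weak_subgradient_of_directional[OF wc])
  fix d :: 'a and e :: real
  assume e: "0 < e"
  have "((\<lambda>t. \<sigma> / 2 * (t * (norm d)\<^sup>2)) \<longlongrightarrow> 0) (at_right 0)"
    by (auto intro!: tendsto_eq_intros)
  then have "\<forall>\<^sub>F t in at_right 0. \<sigma> / 2 * (t * (norm d)\<^sup>2) < e"
    using e by (rule order_tendstoD)
  moreover have "\<forall>\<^sub>F t::real in at_right 0. 0 < t"
    by (rule eventually_at_right_less)
  ultimately show "\<forall>\<^sub>F t in at_right 0. h x + t * (v \<bullet> d) - e * t \<le> h (x + t *\<^sub>R d)"
  proof eventually_elim
    fix t :: real
    assume less: "\<sigma> / 2 * (t * (norm d)\<^sup>2) < e" and t: "0 < t"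
    then have "t * (\<sigma> / 2 * (t * (norm d)\<^sup>2)) \<le> t * e"
      by simp
    moreover have "h x + t * (v \<bullet> d) - \<sigma> / 2 * (t\<^sup>2 * (norm d)\<^sup>2) \<le> h (x + t *\<^sub>R d)"
      using weak_subgradientD[OF sub, of "x + t *\<^sub>R d"] by (simp add: power_mult_distrib)
    ultimately show "h x + t * (v \<bullet> d) - e * t \<le> h (x + t *\<^sub>R d)"
      by (simp add: power2_eq_square algebra_simps)
  qed
qed

lemma regular_subdifferential_weak_subgradient:
  fixes h :: "'a::real_inner \<Rightarrow> real"
  assumes wc: "weakly_convex \<rho> h" and v: "v \<in> regular_subdifferential h x"
  shows "weak_subgradient \<rho> h x v"
proof (rule weak_subgradient_of_directional[OF wc])
  fix d :: 'a and e :: real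
  assume e: "0 < e"
  show "\<forall>\<^sub>F t in at_right 0. h x + t * (v \<bullet> d) - e * t \<le> h (x + t *\<^sub>R d)"
  proof (cases "d = 0")
    case True
    then show ?thesis
      using e by (auto intro: eventually_mono[OF eventually_at_right_less[of 0]])
  next
    case d: False
    have "ereal (- (e / norm d)) < Liminf (at x) (\<lambda>y. ereal ((h y - h x - v \<bullet> (y - x)) / norm (y - x)))"
    proof (rule less_le_trans)
      show "ereal (- (e / norm d)) < 0"
        using d e by simp
    qed (use v in \<open>simp add: regular_subdifferential_def\<close>)
    then have ev: "\<forall>\<^sub>F y in at x. - (e / norm d) < (h y - h x - v \<bullet> (y - x)) / norm (y - x)"
      by (auto dest: less_LiminfD)
    have "filterlim (\<lambda>t. x + t *\<^sub>R d) (at x) (at_right 0)"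
      unfolding filterlim_at
    proof
      show "((\<lambda>t. x + t *\<^sub>R d) \<longlongrightarrow> x) (at_right 0)"
        by (auto intro!: tendsto_eq_intros)
      show "\<forall>\<^sub>F t in at_right 0. x + t *\<^sub>R d \<in> UNIV \<and> x + t *\<^sub>R d \<noteq> x"
        using d by (auto intro: eventually_mono[OF eventually_at_right_less[of 0]])
    qed
    from filterlim_iff[THEN iffD1, OF this, rule_format, OF ev] eventually_at_right_less[of 0]
    show ?thesis
    proof eventually_elim
      fix t :: real
      assume t: "0 < t"
        and "- (e / norm d) < (h (x + t *\<^sub>R d) - h x - v \<bullet> (x + t *\<^sub>R d - x)) / norm (x + t *\<^sub>R d - x)"
      then have "- (e / norm d) * (t * norm d) < h (x + t *\<^sub>R d) - h x - t * (v \<bullet> d)"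
        using d by (simp add: field_simps)
      then show "h x + t * (v \<bullet> d) - e * t \<le> h (x + t *\<^sub>R d)"
        using d by (simp add: field_simps)
    qed
  qed
qed

text \<open>
  Being global, the inequality for regular subgradients survives the limit; the convergence of the
  values \<open>h (X n)\<close> in the definition is what the constant term needs.
\<close>

lemma limiting_subdifferential_weak_subgradient:
  fixes h :: "'a::real_inner \<Rightarrow> real"
  assumes wc: "weakly_convex \<rho> h" and v: "v \<in> limiting_subdifferential h x"
  shows "weak_subgradient \<rho> h x v"
  unfolding weak_subgradient_def
proof
  fix y
  obtain X V where X: "X \<longlonglongrightarrow> x" and hX: "(\<lambda>n. h (X n)) \<longlonglongrightarrow> h x"
    and V: "V \<longlonglongrightarrow> v" and reg: "\<And>n::nat. V n \<in> regular_subdifferential h (X n)"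
    using v by (auto simp: limiting_subdifferential_def)
  show "h x + v \<bullet> (y - x) - \<rho> / 2 * (norm (y - x))\<^sup>2 \<le> h y"
  proof (rule tendsto_upperbound)
    show "(\<lambda>n. h (X n) + V n \<bullet> (y - X n) - \<rho> / 2 * (norm (y - X n))\<^sup>2)
        \<longlonglongrightarrow> h x + v \<bullet> (y - x) - \<rho> / 2 * (norm (y - x))\<^sup>2"
      by (intro tendsto_intros X hX V)
    show "\<forall>\<^sub>F n in sequentially.
        h (X n) + V n \<bullet> (y - X n) - \<rho> / 2 * (norm (y - X n))\<^sup>2 \<le> h y"
      using weak_subgradientD[OF regular_subdifferential_weak_subgradient[OF wc reg]]
      by (intro always_eventually) blast
  qed simp
qed

text \<open>
  The sum rule, read backwards: subtracting the smooth terms of the augmented Lagrangian shifts the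
  subgradient by their gradient and spoils the modulus by the curvature of the penalty, which
  sharpening then removes.
\<close>

lemma weak_subgradient_aug_lagrangian_objective:
  fixes A :: "real^'n^'m"
  assumes wc: "weakly_convex \<rho> f" and beta: "0 \<le> \<beta>"
    and sub: "weak_subgradient \<rho> (\<lambda>y. aug_lagrangian f A b \<beta> y lam) x v"
  shows "weak_subgradient \<rho> f x (v - (lam + \<beta> *\<^sub>R (A *v x - b)) v* A)"
proof (rule weak_subgradient_sharpen[OF wc])
  define K where "K = \<beta> * (onorm ((*v) A))\<^sup>2"
  show "weak_subgradient (\<rho> + K) f x (v - (lam + \<beta> *\<^sub>R (A *v x - b)) v* A)"
    unfolding weak_subgradient_def
  proof
    fix y
    let ?r = "A *v x - b" and ?d = "y - x"
    have "norm (A *v ?d) \<le> onorm ((*v) A) * norm ?d"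
      by (rule onorm) simp
    then have "(norm (A *v ?d))\<^sup>2 \<le> (onorm ((*v) A) * norm ?d)\<^sup>2"
      by (rule power_mono) simp
    then have quad: "\<beta> / 2 * (norm (A *v ?d))\<^sup>2 \<le> K / 2 * (norm ?d)\<^sup>2"
      using beta mult_left_mono[of "(norm (A *v ?d))\<^sup>2" _ \<beta>]
      by (simp add: K_def power_mult_distrib mult.assoc)
    have r: "A *v y - b = ?r + A *v ?d"
      by (simp add: matrix_vector_mult_diff_distrib)
    have sq: "(norm (?r + A *v ?d))\<^sup>2 = (norm ?r)\<^sup>2 + 2 * (?r \<bullet> (A *v ?d)) + (norm (A *v ?d))\<^sup>2"
      by (simp only: power2_norm_eq_inner) (simp add: inner_commute algebra_simps)
    have "((lam + \<beta> *\<^sub>R ?r) v* A) \<bullet> ?d = lam \<bullet> (A *v ?d) + \<beta> * (?r \<bullet> (A *v ?d))"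
      by (simp add: dot_lmul_matrix inner_add_left)
    then show "f x + (v - (lam + \<beta> *\<^sub>R ?r) v* A) \<bullet> ?d - (\<rho> + K) / 2 * (norm ?d)\<^sup>2 \<le> f y"
      using weak_subgradientD[OF sub, of y] quad
      unfolding aug_lagrangian_def r sq
      by (simp add: inner_diff_left inner_add_right algebra_simps add_divide_distrib)
  qed
qed

section \<open>The smallest positive eigenvalue of the Gram matrix\<close>

text \<open>
  The quadratic form \<open>|A^T v|^2\<close> attains its minimum \<open>m\<close> on the unit sphere of the range of \<open>A\<close>.
  At a minimizer \<open>u\<close> the first variation vanishes in every direction of the range, in particular
  in the direction \<open>A A^T u - m u\<close>, so \<open>u\<close> is an eigenvector of \<open>A A^T\<close>, and \<open>A^T u\<close> one of
  \<open>A^T A\<close>, for the eigenvalue \<open>m\<close>. Conversely every positive eigenvalue of \<open>A^T A\<close> with eigenvector \<open>y\<close> is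
  the value of the form at the normalization of \<open>A y\<close>, hence at least \<open>m\<close>.
\<close>

lemma min_pos_eigenvalue_gram:
  fixes A :: "real^'n^'m"
  assumes "A \<noteq> 0"
  shows "0 < min_pos_eigenvalue (transpose A ** A)"
    and "v \<in> range ((*v) A) \<Longrightarrow>
      min_pos_eigenvalue (transpose A ** A) * (norm v)\<^sup>2 \<le> (norm (v v* A))\<^sup>2"
proof -
  let ?R = "range ((*v) A)"
  have sub: "subspace ?R"
    by (intro linear_subspace_image) auto
  obtain p where p: "A *v p \<noteq> 0"
    using assms by (metis matrix_eq matrix_vector_mult_0)
  have tv: "transpose A ** A *v y = (A *v y) v* A" for y
    by (simp flip: matrix_vector_mul_assoc)
  have lin: "linear (\<lambda>v. v v* A)"
    using matrix_vector_mul_linear[of "transpose A"] by simp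
  define S where "S = ?R \<inter> sphere 0 1"
  have "compact S"
    unfolding S_def by (intro closed_Int_compact closed_subspace sub) simp
  moreover have "(1 / norm (A *v p)) *\<^sub>R (A *v p) \<in> S"
    using p sub by (auto simp: S_def intro!: subspace_scale[OF sub])
  then have "S \<noteq> {}" by auto
  moreover have "continuous_on S (\<lambda>v. (norm (v v* A))\<^sup>2)"
    using lin by (intro continuous_intros linear_continuous_on) (simp add: linear_conv_bounded_linear)
  ultimately obtain u where u: "u \<in> S" and min: "\<And>v. v \<in> S \<Longrightarrow> (norm (u v* A))\<^sup>2 \<le> (norm (v v* A))\<^sup>2"
    using continuous_attains_inf[of S "\<lambda>v. (norm (v v* A))\<^sup>2"] by auto
  define m where "m = (norm (u v* A))\<^sup>2"
  have nu: "norm u = 1" and uR: "u \<in> ?R"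
    using u by (auto simp: S_def)
  have bound: "m * (norm v)\<^sup>2 \<le> (norm (v v* A))\<^sup>2" if v: "v \<in> ?R" for v
  proof (cases "v = 0")
    case False
    have "(1 / norm v) *\<^sub>R v \<in> S"
      using v False by (auto simp: S_def intro!: subspace_scale[OF sub])
    from min[OF this] show ?thesis
      using False by (simp add: m_def linear_scale[OF lin] power_divide field_simps)
  qed simp
  define w where "w = A *v (u v* A) - m *\<^sub>R u"
  have wR: "w \<in> ?R"
    unfolding w_def by (intro subspace_diff[OF sub] subspace_scale[OF sub] uR) auto
  define q where "q = (norm (w v* A))\<^sup>2 - m * (norm w)\<^sup>2"
  define c where "c = w \<bullet> w"
  have q: "0 \<le> q"
    using bound[OF wR] by (simp add: q_def)
  have c: "(u v* A) \<bullet> (w v* A) - m * (u \<bullet> w) = c"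
  proof -
    have "(u v* A) \<bullet> (w v* A) = w \<bullet> (A *v (u v* A))"
      by (metis dot_lmul_matrix inner_commute)
    moreover have "c = w \<bullet> (A *v (u v* A) - m *\<^sub>R u)"
      by (simp add: c_def w_def)
    ultimately show ?thesis
      by (simp add: inner_diff_right inner_commute)
  qed
  have nonneg: "0 \<le> 2 * t * c + t\<^sup>2 * q" for t :: real
  proof -
    have "m * (norm (u + t *\<^sub>R w))\<^sup>2 \<le> (norm ((u + t *\<^sub>R w) v* A))\<^sup>2"
      by (intro bound subspace_add[OF sub] subspace_scale[OF sub] uR wR)
    moreover have "(norm ((u + t *\<^sub>R w) v* A))\<^sup>2
        = (norm (u v* A))\<^sup>2 + 2 * t * ((u v* A) \<bullet> (w v* A)) + t\<^sup>2 * (norm (w v* A))\<^sup>2"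
      unfolding linear_add[OF lin] linear_scale[OF lin] power2_norm_eq_inner
      by (simp add: inner_commute power2_eq_square algebra_simps)
    moreover have "(norm (u + t *\<^sub>R w))\<^sup>2 = 1 + 2 * t * (u \<bullet> w) + t\<^sup>2 * (norm w)\<^sup>2"
      using nu unfolding norm_eq_1 power2_norm_eq_inner
      by (simp add: inner_commute power2_eq_square algebra_simps)
    ultimately show ?thesis
      unfolding q_def c[symmetric] by (simp add: m_def algebra_simps)
  qed
  (* the minimizer of 2 t c + t^2 (1 + q), which avoids dividing by a possibly vanishing q *)
  define t where "t = - c / (1 + q)"
  have t: "t * (1 + q) = - c"
    using q by (simp add: t_def)
  have "0 \<le> (2 * t * c + t\<^sup>2 * q) * (1 + q)\<^sup>2"
    using nonneg[of t] by simp
  also have "\<dots> = 2 * (t * (1 + q)) * c * (1 + q) + (t * (1 + q))\<^sup>2 * q"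
    by (simp add: power2_eq_square algebra_simps)
  also have "\<dots> = - (c\<^sup>2 * (2 + q))"
    unfolding t by (simp add: power2_eq_square algebra_simps)
  finally have "c = 0"
    using q by (simp add: mult_le_0_iff)
  then have eig: "A *v (u v* A) = m *\<^sub>R u"
    by (simp add: c_def w_def)
  have uA: "u v* A \<noteq> 0"
  proof
    assume "u v* A = 0"
    moreover obtain r where "u = A *v r"
      using uR by auto
    ultimately have "u \<bullet> u = 0"
      using dot_lmul_matrix[of u A r] by simp
    then show False
      using nu by simp
  qed
  then have m: "0 < m"
    by (simp add: m_def)
  have "min_pos_eigenvalue (transpose A ** A) = m"
    unfolding min_pos_eigenvalue_def
  proof (rule Least_equality)
    show "0 < m \<and> eigenvalue (transpose A ** A) m"
      using m uA eig by (auto simp: eigenvalue_def tv linear_scale[OF lin])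
  next
    fix \<mu> assume "0 < \<mu> \<and> eigenvalue (transpose A ** A) \<mu>"
    then obtain y where mu: "0 < \<mu>" and y: "y \<noteq> 0" and ev: "(A *v y) v* A = \<mu> *\<^sub>R y"
      by (auto simp: eigenvalue_def tv)
    have n: "\<mu> * (norm y)\<^sup>2 = (norm (A *v y))\<^sup>2"
      using dot_lmul_matrix[of "A *v y" A y] by (simp add: ev power2_norm_eq_inner)
    have "m * (norm (A *v y))\<^sup>2 \<le> \<mu>\<^sup>2 * (norm y)\<^sup>2"
      using bound[of "A *v y"] mu by (simp add: ev power_mult_distrib)
    also have "\<dots> = \<mu> * (norm (A *v y))\<^sup>2"
      unfolding n[symmetric] by (simp add: power2_eq_square)
    finally have "m * (norm (A *v y))\<^sup>2 \<le> \<mu> * (norm (A *v y))\<^sup>2" .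
    moreover have "0 < (norm (A *v y))\<^sup>2"
      unfolding n[symmetric] using mu y by simp
    ultimately show "m \<le> \<mu>"
      by simp
  qed
  then show "0 < min_pos_eigenvalue (transpose A ** A)"
    and "v \<in> ?R \<Longrightarrow> min_pos_eigenvalue (transpose A ** A) * (norm v)\<^sup>2 \<le> (norm (v v* A))\<^sup>2"
    using m bound by auto
qed

section \<open>Envelopes and their gradients\<close>

lemma gradient_eqI:
  assumes "GDERIV h x :> D"
  shows "gradient h x = D"
  unfolding gradient_def
proof (rule the_equality[where P = "\<lambda>D. GDERIV h x :> D", OF assms])
  fix D' assume "GDERIV h x :> D'"
  with assms have "(\<lambda>k. k \<bullet> D') = (\<lambda>k. k \<bullet> D)"
    unfolding gderiv_def by (rule has_derivative_unique[rotated])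
  then have "(D' - D) \<bullet> (D' - D) = 0"
    by (metis inner_diff_right right_minus_eq)
  then show "D' = D"
    by simp
qed

text \<open>
  Danskin's argument with a quadratic error. The minimizer for the parameter \<open>p\<close>, used at \<open>q\<close>,
  bounds the envelope from above. From below, a competitor \<open>y\<close> may change the slope in the
  parameter by at most \<open>B * |y - x|\<close>, and the quadratic growth of the objective at its minimizer
  absorbs this at the price \<open>B^2 / (2 \<mu>) * |q - p|^2\<close>. Both estimates involve
  the minimizer for \<open>p\<close> alone.
\<close>

lemma envelope_theorem:
  fixes G :: "'a::real_inner \<Rightarrow> 'p::real_inner \<Rightarrow> real" and T :: "'a \<Rightarrow> 'p"
  assumes mu: "0 < \<mu>"
    and min: "weak_subgradient (- \<mu>) (\<lambda>y. G y p) x 0"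
    and expand: "\<And>y q. \<bar>G y q - G y p - T y \<bullet> (q - p)\<bar> \<le> C * (norm (q - p))\<^sup>2"
    and lip: "\<And>y. norm (T y - T x) \<le> B * norm (y - x)"
  shows "GDERIV (\<lambda>q. INF y. G y q) p :> T x"
proof -
  define \<phi> where "\<phi> q = (INF y. G y q)" for q
  define K where "K = B\<^sup>2 / (2 * \<mu>) + C"
  have lower: "G x p + T x \<bullet> (q - p) - K * (norm (q - p))\<^sup>2 \<le> G y q" for y q
  proof -
    let ?u = "norm (y - x)" and ?d = "norm (q - p)"
    have "\<bar>(T y - T x) \<bullet> (q - p)\<bar> \<le> norm (T y - T x) * ?d"
      by (rule Cauchy_Schwarz_ineq2)
    also have "\<dots> \<le> B * ?u * ?d"
      by (intro mult_right_mono lip) simp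
    finally have "- (B * ?u * ?d) \<le> (T y - T x) \<bullet> (q - p)"
      by linarith
    moreover have "\<mu> / 2 * (?u - B / \<mu> * ?d)\<^sup>2
        = \<mu> / 2 * ?u\<^sup>2 - B * ?u * ?d + B\<^sup>2 / (2 * \<mu>) * ?d\<^sup>2"
      using mu by (simp add: power2_eq_square field_simps)
    moreover have "0 \<le> \<mu> / 2 * (?u - B / \<mu> * ?d)\<^sup>2"
      using mu by simp
    moreover have "G x p + \<mu> / 2 * ?u\<^sup>2 \<le> G y p"
      using weak_subgradientD[OF min, of y] by simp
    moreover have "G y p + T y \<bullet> (q - p) - C * ?d\<^sup>2 \<le> G y q"
      using expand[of y q] by linarith
    ultimately show ?thesis
      by (simp add: K_def inner_diff_left distrib_right)
  qed
  have bdd: "bdd_below (range (\<lambda>y. G y q))" for q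
    by (rule bdd_belowI2) (rule lower)
  have "\<phi> p = G x p"
    unfolding \<phi>_def
  proof (rule antisym)
    show "(INF y. G y p) \<le> G x p"
      by (intro cINF_lower bdd) simp
    show "G x p \<le> (INF y. G y p)"
      using lower[of p] by (intro cINF_greatest) auto
  qed
  have est: "\<bar>\<phi> q - \<phi> p - T x \<bullet> (q - p)\<bar> \<le> K * (norm (q - p))\<^sup>2" for q
  proof -
    have "G x p + T x \<bullet> (q - p) - K * (norm (q - p))\<^sup>2 \<le> \<phi> q"
      unfolding \<phi>_def using lower by (intro cINF_greatest) auto
    moreover have "\<phi> q \<le> G x q"
      unfolding \<phi>_def by (intro cINF_lower bdd) simp
    moreover have "C * (norm (q - p))\<^sup>2 \<le> K * (norm (q - p))\<^sup>2"
      using mu by (intro mult_right_mono) (simp_all add: K_def)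
    ultimately show ?thesis
      using expand[of x q] \<open>\<phi> p = G x p\<close> by linarith
  qed
  have "(\<phi> has_derivative (\<lambda>k. k \<bullet> T x)) (at p)"
    unfolding has_derivative_at2
  proof
    show "bounded_linear (\<lambda>k. k \<bullet> T x)"
      by (rule bounded_linear_inner_left)
    show "((\<lambda>q. (1 / norm (q - p)) *\<^sub>R (\<phi> q - (\<phi> p + (q - p) \<bullet> T x))) \<longlongrightarrow> 0) (at p)"
    proof (rule Lim_null_comparison)
      show "((\<lambda>q. K * norm (q - p)) \<longlongrightarrow> 0) (at p)"
        by (auto intro!: tendsto_eq_intros)
      have "norm ((1 / norm (q - p)) *\<^sub>R (\<phi> q - (\<phi> p + (q - p) \<bullet> T x))) \<le> K * norm (q - p)"
        if "q \<noteq> p" for q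
        using est[of q] that
        by (simp add: inner_commute field_simps power2_eq_square abs_le_iff)
      then show "\<forall>\<^sub>F q in at p. norm ((1 / norm (q - p)) *\<^sub>R (\<phi> q - (\<phi> p + (q - p) \<bullet> T x)))
          \<le> K * norm (q - p)"
        by (auto simp: eventually_at_filter)
    qed
  qed
  then show ?thesis
    by (simp add: gderiv_def \<phi>_def[abs_def])
qed

text \<open>
  The optimality condition of the proximal problem centred at \<open>x + \<gamma> w\<close> reads \<open>w + (x - z) / \<gamma> = 0\<close>
  at \<open>x\<close>. Thus each subgradient identifies a point at which the proximal map and the gradient of the
  Moreau envelope are explicitly known.
\<close>

lemma prox_and_moreau_gradient:
  fixes f :: "'a::real_inner \<Rightarrow> real"
  assumes g: "0 < \<gamma>" and rg: "\<rho> < 1 / \<gamma>" and sub: "weak_subgradient \<rho> f x w"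
  shows "prox \<gamma> f (x + \<gamma> *\<^sub>R w) = x"
    and "gradient (moreau \<gamma> f) (x + \<gamma> *\<^sub>R w) = w"
proof -
  define z where "z = x + \<gamma> *\<^sub>R w"
  define G where "G y q = f y + 1 / (2 * \<gamma>) * (norm (y - q))\<^sup>2" for y q :: 'a
  have z0: "w + (1 / \<gamma>) *\<^sub>R (x - z) = 0"
    using g by (simp add: z_def)
  have min: "weak_subgradient (- (1 / \<gamma> - \<rho>)) (\<lambda>y. G y z) x 0"
    using weak_subgradient_add[OF sub weak_subgradient_proximal_term[of "1 / \<gamma>" z x]]
    unfolding z0 by (simp add: G_def mult.commute)
  have less: "G x z < G y z" if "y \<noteq> x" for y
  proof -
    (* strict growth makes the minimizer unique, so that the choice in ARG_MIN is determined *)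
    have "0 < (1 / \<gamma> - \<rho>) / 2 * (norm (y - x))\<^sup>2"
      using rg that by simp
    then show ?thesis
      using weak_subgradientD[OF min, of y] by (simp add: left_diff_distrib diff_divide_distrib)
  qed
  have "is_arg_min (\<lambda>y. G y z) (\<lambda>_. True) y \<longleftrightarrow> y = x" for y
    unfolding is_arg_min_def using less by (metis less_asym)
  then show "prox \<gamma> f (x + \<gamma> *\<^sub>R w) = x"
    by (simp add: prox_def arg_min_def G_def z_def)
  have "GDERIV (\<lambda>q. INF y. G y q) z :> (1 / \<gamma>) *\<^sub>R (z - x)"
  proof (rule envelope_theorem[where G = G and T = "\<lambda>y. (1 / \<gamma>) *\<^sub>R (z - y)", OF _ min])
    show "0 < 1 / \<gamma> - \<rho>"
      using rg by simp
    fix y q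
    have "(norm (y - q))\<^sup>2 = (norm (y - z))\<^sup>2 + 2 * ((z - y) \<bullet> (q - z)) + (norm (q - z))\<^sup>2"
      by (simp only: power2_norm_eq_inner) (simp add: inner_commute algebra_simps)
    then show "\<bar>G y q - G y z - (1 / \<gamma>) *\<^sub>R (z - y) \<bullet> (q - z)\<bar> \<le> 1 / (2 * \<gamma>) * (norm (q - z))\<^sup>2"
      using g by (simp add: G_def distrib_left)
    have "(1 / \<gamma>) *\<^sub>R (z - y) - (1 / \<gamma>) *\<^sub>R (z - x) = (1 / \<gamma>) *\<^sub>R (x - y)"
      by (simp add: algebra_simps)
    then show "norm ((1 / \<gamma>) *\<^sub>R (z - y) - (1 / \<gamma>) *\<^sub>R (z - x)) \<le> 1 / \<gamma> * norm (y - x)"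
      using g by (simp add: norm_minus_commute)
  qed
  moreover have "moreau \<gamma> f = (\<lambda>q. INF y. G y q)"
    by (simp add: moreau_def G_def fun_eq_iff)
  ultimately show "gradient (moreau \<gamma> f) (x + \<gamma> *\<^sub>R w) = w"
    using gradient_eqI g by (simp add: z_def)
qed

lemma meal_envelope_gradient:
  fixes A :: "real^'n^'m"
  assumes g: "0 < \<gamma>" and mu: "0 < \<mu>"
    and min: "weak_subgradient (- \<mu>) (\<lambda>y. prox_lagrangian f A b \<gamma> \<beta> y z lam) x 0"
  shows "gradient (meal_envelope f A b \<gamma> \<beta>) (z, lam) = ((1 / \<gamma>) *\<^sub>R (z - x), A *v x - b)"
proof (rule gradient_eqI)
  define G where "G y q = prox_lagrangian f A b \<gamma> \<beta> y (fst q) (snd q)" for y q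
  define T where "T y = ((1 / \<gamma>) *\<^sub>R (z - y), A *v y - b)" for y
  have "GDERIV (\<lambda>q. INF y. G y q) (z, lam) :> T x"
  proof (rule envelope_theorem[OF mu])
    show "weak_subgradient (- \<mu>) (\<lambda>y. G y (z, lam)) x 0"
      using min by (simp add: G_def)
    fix y and q :: "(real^'n) \<times> (real^'m)"
    obtain z' lam' where q: "q = (z', lam')"
      by (cases q)
    have "(norm (y - z'))\<^sup>2 = (norm (y - z))\<^sup>2 + 2 * ((z - y) \<bullet> (z' - z)) + (norm (z' - z))\<^sup>2"
      by (simp only: power2_norm_eq_inner) (simp add: inner_commute algebra_simps)
    moreover have "lam' \<bullet> (A *v y - b) = lam \<bullet> (A *v y - b) + (A *v y - b) \<bullet> (lam' - lam)"
      by (simp add: inner_diff_right inner_commute)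
    ultimately have "G y q - G y (z, lam) - T y \<bullet> (q - (z, lam)) = 1 / (2 * \<gamma>) * (norm (z' - z))\<^sup>2"
      using g by (simp add: q G_def T_def prox_lagrangian_def aug_lagrangian_def distrib_left add_divide_distrib)
    moreover have "(norm (z' - z))\<^sup>2 \<le> (norm (q - (z, lam)))\<^sup>2"
      by (simp add: q norm_Pair)
    ultimately show "\<bar>G y q - G y (z, lam) - T y \<bullet> (q - (z, lam))\<bar>
        \<le> 1 / (2 * \<gamma>) * (norm (q - (z, lam)))\<^sup>2"
      using g by (simp add: divide_right_mono)
    have "T y - T x = (- ((1 / \<gamma>) *\<^sub>R (y - x)), A *v (y - x))"
      by (simp add: T_def algebra_simps)
    then have "norm (T y - T x) \<le> norm (- ((1 / \<gamma>) *\<^sub>R (y - x))) + norm (A *v (y - x))"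
      using norm_Pair_le by metis
    also have "\<dots> \<le> 1 / \<gamma> * norm (y - x) + onorm ((*v) A) * norm (y - x)"
      using g onorm[of "(*v) A" "y - x"] by simp
    finally show "norm (T y - T x) \<le> (1 / \<gamma> + onorm ((*v) A)) * norm (y - x)"
      by (simp add: distrib_right)
  qed
  moreover have "meal_envelope f A b \<gamma> \<beta> = (\<lambda>q. INF y. G y q)"
    by (auto simp: meal_envelope_def G_def)
  ultimately show "GDERIV (meal_envelope f A b \<gamma> \<beta>) (z, lam) :> ((1 / \<gamma>) *\<^sub>R (z - x), A *v x - b)"
    by (simp add: T_def)
qed

text \<open>
  The quadratic minorant at an approximately stationary point exceeds \<open>h x\<close> outside the ball of
  radius \<open>2 |s| / \<mu>\<close> around \<open>x\<close>. So a minimizer over this ball, on which \<open>h\<close> is continuous, is a global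
  one, and the radius bounds its distance to \<open>x\<close>.
\<close>

lemma strongly_convex_minimizer:
  fixes h :: "'a::euclidean_space \<Rightarrow> real"
  assumes mu: "0 < \<mu>" and wc: "weakly_convex (- \<mu>) h" and sub: "weak_subgradient (- \<mu>) h x s"
  obtains y where "weak_subgradient (- \<mu>) h y 0" "norm (y - x) \<le> 2 / \<mu> * norm s"
proof -
  define r where "r = 2 / \<mu> * norm s"
  have r: "0 \<le> r"
    using mu by (simp add: r_def)
  have "continuous_on UNIV (\<lambda>y. (h y + - \<mu> / 2 * (norm y)\<^sup>2) + \<mu> / 2 * (norm y)\<^sup>2)"
    by (intro continuous_on_add convex_on_continuous wc[unfolded weakly_convex_def] continuous_intros) simp
  then have "continuous_on (cball x r) h"
    by (auto intro: continuous_on_subset)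
  then obtain y where y: "y \<in> cball x r" and least: "\<And>u. u \<in> cball x r \<Longrightarrow> h y \<le> h u"
    using continuous_attains_inf[of "cball x r" h] r by auto
  have "h y \<le> h u" for u
  proof (cases "u \<in> cball x r")
    case False
    then have "r \<le> norm (u - x)"
      by (simp add: dist_norm norm_minus_commute)
    then have "norm s * norm (u - x) \<le> \<mu> / 2 * (norm (u - x))\<^sup>2"
      using mu mult_right_mono[of r "norm (u - x)" "\<mu> / 2 * norm (u - x)"]
      by (simp add: r_def power2_eq_square field_simps)
    moreover have "\<bar>s \<bullet> (u - x)\<bar> \<le> norm s * norm (u - x)"
      by (rule Cauchy_Schwarz_ineq2)
    ultimately have "h x \<le> h u"
      using weak_subgradientD[OF sub, of u] by simp
    then show ?thesis
      using least[of x] r by simp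
  qed (rule least)
  then have "weak_subgradient 0 h y 0"
    by (simp add: weak_subgradient_def)
  then have "weak_subgradient (- \<mu>) h y 0"
    by (rule weak_subgradient_sharpen[OF wc])
  then show ?thesis
    using that y by (simp add: r_def dist_norm norm_minus_commute)
qed

lemma weakly_convex_aug_lagrangian:
  assumes "weakly_convex \<rho> f" "0 \<le> \<beta>"
  shows "weakly_convex \<rho> (\<lambda>y. aug_lagrangian f A b \<beta> y lam)"
  using weakly_convex_add[OF assms(1) weakly_convex_quadratic_affine[OF assms(2)]]
  by (simp add: aug_lagrangian_def add.assoc)

lemma weakly_convex_prox_lagrangian:
  assumes "weakly_convex \<rho> f" "0 \<le> \<beta>"
  shows "weakly_convex (\<rho> - 1 / \<gamma>) (\<lambda>y. prox_lagrangian f A b \<gamma> \<beta> y z lam)"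
  using weakly_convex_add[OF weakly_convex_aug_lagrangian[OF assms]
      weakly_convex_proximal_term[of "1 / \<gamma>" z]]
  by (simp add: prox_lagrangian_def mult.commute)

lemma weak_subgradient_prox_lagrangian:
  assumes "weak_subgradient \<rho> (\<lambda>y. aug_lagrangian f A b \<beta> y lam) x v"
  shows "weak_subgradient (\<rho> - 1 / \<gamma>) (\<lambda>y. prox_lagrangian f A b \<gamma> \<beta> y z lam) x
    (v + (1 / \<gamma>) *\<^sub>R (x - z))"
  using weak_subgradient_add[OF assms weak_subgradient_proximal_term[of "1 / \<gamma>" z]]
  by (simp add: prox_lagrangian_def mult.commute)

section \<open>Sequences of reals\<close>

text \<open>
  The minimum up to \<open>k\<close> is at most each of the terms between \<open>k / 2\<close> and \<open>k\<close>, so that \<open>k / 2\<close> times its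
  square is at most a block of the convergent series that tends to \<open>0\<close>.
\<close>

lemma Min_square_summable_smallo:
  fixes a :: "nat \<Rightarrow> real"
  assumes nonneg: "\<And>k. 0 \<le> a k" and sum: "summable (\<lambda>k. (a k)\<^sup>2)"
  shows "(\<lambda>k. Min (a ` {0..k})) \<in> o(\<lambda>k. 1 / sqrt (real k))"
proof (rule smalloI_tendsto)
  define m where "m k = Min (a ` {0..k})" for k
  define S where "S n = (\<Sum>k<n. (a k)\<^sup>2)" for n
  have m0: "0 \<le> m k" for k
    using nonneg by (simp add: m_def)
  have upper: "(m k * sqrt (real k))\<^sup>2 \<le> 2 * (S k - S (k div 2))" for k
  proof -
    have "real k / 2 * (m k)\<^sup>2 \<le> real (k - k div 2) * (m k)\<^sup>2"
      by (intro mult_right_mono) auto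
    also have "\<dots> = (\<Sum>t\<in>{k div 2..<k}. (m k)\<^sup>2)"
      by simp
    also have "\<dots> \<le> (\<Sum>t\<in>{k div 2..<k}. (a t)\<^sup>2)"
      using m0 by (intro sum_mono power_mono) (auto simp: m_def intro!: Min_le)
    also have "\<dots> = S k - S (k div 2)"
      unfolding S_def by (subst sum_diff[symmetric]) (auto intro!: sum.cong)
    finally show ?thesis
      by (simp add: power_mult_distrib mult.commute)
  qed
  have limit: "(\<lambda>k. 2 * (S k - S (k div 2))) \<longlonglongrightarrow> 2 * ((\<Sum>k. (a k)\<^sup>2) - (\<Sum>k. (a k)\<^sup>2))"
  proof (intro tendsto_intros)
    show "S \<longlonglongrightarrow> (\<Sum>k. (a k)\<^sup>2)"
      unfolding S_def by (rule summable_LIMSEQ[OF sum])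
    then show "(\<lambda>k. S (k div 2)) \<longlonglongrightarrow> (\<Sum>k. (a k)\<^sup>2)"
      by (rule filterlim_compose) (simp add: filterlim_at_top_div_const_nat)
  qed
  have "(\<lambda>k. (m k * sqrt (real k))\<^sup>2) \<longlonglongrightarrow> 0"
  proof (rule tendsto_sandwich[OF _ _ tendsto_const])
    show "(\<lambda>k. 2 * (S k - S (k div 2))) \<longlonglongrightarrow> 0"
      using limit by simp
  qed (use upper in auto)
  from tendsto_real_sqrt[OF this] have "(\<lambda>k. m k * sqrt (real k)) \<longlonglongrightarrow> 0"
    using m0 by simp
  then show "(\<lambda>k. Min (a ` {0..k}) / (1 / sqrt (real k))) \<longlonglongrightarrow> 0"
    by (simp add: m_def)
  show "\<forall>\<^sub>F k in sequentially. 1 / sqrt (real k) \<noteq> 0"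
    by (auto intro: eventually_mono[OF eventually_gt_at_top[of 0]])
qed

lemma telescoping_sum_bound:
  fixes E g e :: "nat \<Rightarrow> real"
  assumes "\<And>k. E (Suc k) + g k \<le> E k + e k"
  shows "(\<Sum>k<n. g k) \<le> E 0 - E n + (\<Sum>k<n. e k)"
proof (induction n)
  case (Suc n)
  then show ?case
    using assms[of n] by simp
qed simp

lemma power2_le_add2: "(p + q)\<^sup>2 \<le> 2 * p\<^sup>2 + 2 * q\<^sup>2" for p q :: real
  using zero_le_power2[of "p - q"] by (simp add: power2_eq_square algebra_simps)

lemma power2_le_add3:
  fixes D p q r :: real
  assumes "0 \<le> D" "D \<le> p + q + r"
  shows "D\<^sup>2 \<le> 3 * p\<^sup>2 + 3 * q\<^sup>2 + 3 * r\<^sup>2"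
proof -
  have "D\<^sup>2 \<le> (p + q + r)\<^sup>2"
    using assms by (intro power_mono)
  also have "\<dots> \<le> 3 * p\<^sup>2 + 3 * q\<^sup>2 + 3 * r\<^sup>2"
    using zero_le_power2[of "p - q"] zero_le_power2[of "q - r"] zero_le_power2[of "p - r"]
    by (simp add: power2_eq_square algebra_simps)
  finally show ?thesis .
qed

lemma power2_le_add4:
  fixes D p q r t :: real
  assumes "0 \<le> D" "D \<le> p + q + r + t"
  shows "D\<^sup>2 \<le> 4 * p\<^sup>2 + 4 * q\<^sup>2 + 4 * r\<^sup>2 + 4 * t\<^sup>2"
proof -
  have "D\<^sup>2 \<le> ((p + q) + (r + t))\<^sup>2"
    using assms by (intro power_mono) auto
  then show ?thesis
    using power2_le_add2[of "p + q" "r + t"] power2_le_add2[of p q] power2_le_add2[of r t]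
    by linarith
qed

text \<open>
  Young's inequality, used to absorb an inexactness error into a primal decrease.
\<close>

lemma mult_le_square_add: "0 < \<theta> \<Longrightarrow> e * d \<le> \<theta> * d\<^sup>2 + e\<^sup>2 / (4 * \<theta>)" for \<theta> e d :: real
proof -
  assume t: "0 < \<theta>"
  have "\<theta> * (d - e / (2 * \<theta>))\<^sup>2 = \<theta> * d\<^sup>2 - e * d + e\<^sup>2 / (4 * \<theta>)"
    using t by (simp add: power2_eq_square field_simps)
  moreover have "0 \<le> \<theta> * (d - e / (2 * \<theta>))\<^sup>2"
    using t by simp
  ultimately show ?thesis by linarith
qed

section \<open>Runs of the algorithm\<close>

text \<open>
  A run together with its residuals \<open>s k\<close>, the inclusion for the limiting subdifferential being
  replaced by the global inequality that it implies.
\<close>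

locale imeal_run =
  fixes f :: "real^'n \<Rightarrow> real" and A :: "real^'n^'m" and b :: "real^'m"
    and \<rho> \<gamma> \<eta> :: real and eps \<beta> :: "nat \<Rightarrow> real"
    and x z :: "nat \<Rightarrow> real^'n" and lam :: "nat \<Rightarrow> real^'m" and s :: "nat \<Rightarrow> real^'n"
  assumes wc: "weakly_convex \<rho> f"
    and feasible: "b \<in> range ((*v) A)"
    and rho: "0 < \<rho>" and gamma: "0 < \<gamma>" "\<gamma> < inverse \<rho>"
    and eta: "0 < \<eta>" "\<eta> < 2"
    and beta: "0 < \<beta> k"
    and residual: "norm (s k) \<le> eps k"
    and inexact: "weak_subgradient \<rho> (\<lambda>y. aug_lagrangian f A b (\<beta> k) y (lam k)) (x (Suc k))
      (s k + (1 / \<gamma>) *\<^sub>R (z k - x (Suc k)))"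
    and z_step: "z (Suc k) = z k - \<eta> *\<^sub>R (z k - x (Suc k))"
    and lam_step: "lam (Suc k) = lam k + \<beta> k *\<^sub>R (A *v x (Suc k) - b)"

lemma imeal_obtain_run:
  fixes f :: "real^'n \<Rightarrow> real" and A :: "real^'n^'m"
  assumes "imeal f A b \<gamma> \<eta> eps \<beta> x z lam" "{x. A *v x = b} \<noteq> {}"
    and "weakly_convex \<rho> f" "0 < \<rho>" "0 < \<gamma>" "\<gamma> < inverse \<rho>" "0 < \<eta>" "\<eta> < 2"
    and "\<And>k. 0 < \<beta> k"
  obtains s where "imeal_run f A b \<rho> \<gamma> \<eta> eps \<beta> x z lam s"
proof -
  have "\<exists>s. norm s \<le> eps k \<and>
      weak_subgradient \<rho> (\<lambda>y. aug_lagrangian f A b (\<beta> k) y (lam k)) (x (Suc k))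
        (s + (1 / \<gamma>) *\<^sub>R (z k - x (Suc k)))" for k
  proof -
    obtain g where g: "g \<in> limiting_subdifferential (\<lambda>y. aug_lagrangian f A b (\<beta> k) y (lam k)) (x (Suc k))"
      and n: "norm (g + (1 / \<gamma>) *\<^sub>R (x (Suc k) - z k)) \<le> eps k"
      using assms(1) unfolding imeal_def by blast
    have "weak_subgradient \<rho> (\<lambda>y. aug_lagrangian f A b (\<beta> k) y (lam k)) (x (Suc k)) g"
      using assms(3) assms(9)[of k]
      by (intro limiting_subdifferential_weak_subgradient[OF _ g] weakly_convex_aug_lagrangian) auto
    moreover have "g = (g + (1 / \<gamma>) *\<^sub>R (x (Suc k) - z k)) + (1 / \<gamma>) *\<^sub>R (z k - x (Suc k))"
      by (simp add: algebra_simps)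
    ultimately show ?thesis
      using n by metis
  qed
  then obtain s where "\<And>k. norm (s k) \<le> eps k \<and>
      weak_subgradient \<rho> (\<lambda>y. aug_lagrangian f A b (\<beta> k) y (lam k)) (x (Suc k))
        (s k + (1 / \<gamma>) *\<^sub>R (z k - x (Suc k)))"
    by metis
  then have "imeal_run f A b \<rho> \<gamma> \<eta> eps \<beta> x z lam s"
    using assms by unfold_locales (auto simp: imeal_def)
  then show ?thesis
    by (rule that)
qed

context imeal_run
begin

abbreviation \<mu> :: real where "\<mu> \<equiv> 1 / \<gamma> - \<rho>"
abbreviation \<tau> :: real where "\<tau> \<equiv> 2 / \<eta> - 1"
abbreviation \<kappa> :: real where "\<kappa> \<equiv> \<gamma> * \<eta> * (1 - \<eta> / 2)"

text \<open>
  The subgradient of \<open>f\<close> at \<open>x (k + 1)\<close> that remains after moving the penalty terms to the other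
  side of the stationarity condition. The multiplier update is designed such that the gradient of
  the penalty terms is exactly \<open>A^T lam (k + 1)\<close>.
\<close>

definition objective_subgradient :: "nat \<Rightarrow> real^'n" where
  "objective_subgradient k = s k + (1 / \<gamma>) *\<^sub>R (z k - x (Suc k)) - lam (Suc k) v* A"

definition proximal_value :: "nat \<Rightarrow> real" where
  "proximal_value k = prox_lagrangian f A b \<gamma> (\<beta> k) (x k) (z k) (lam k)"

definition envelope_gradient :: "nat \<Rightarrow> (real^'n) \<times> (real^'m)" where
  "envelope_gradient k = gradient (meal_envelope f A b \<gamma> (\<beta> k)) (z k, lam k)"

lemma mu_pos: "0 < \<mu>"
  using gamma rho by (simp add: field_simps)

lemma tau_pos: "0 < \<tau>"
  using eta by simp

lemma kappa_pos: "0 < \<kappa>"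
  using eta gamma by simp

lemma eps_nonneg: "0 \<le> eps k"
  using residual[of k] norm_ge_zero order_trans by blast

lemma objective_subgradient:
  "weak_subgradient \<rho> f (x (Suc k)) (objective_subgradient k)"
  using weak_subgradient_aug_lagrangian_objective[OF wc less_imp_le[OF beta] inexact]
  by (simp add: objective_subgradient_def lam_step)

lemma prox_lagrangian_subgradient:
  "weak_subgradient (- \<mu>) (\<lambda>y. prox_lagrangian f A b \<gamma> (\<beta> k) y (z k) (lam k)) (x (Suc k)) (s k)"
proof -
  have eq: "s k + (1 / \<gamma>) *\<^sub>R (z k - x (Suc k)) + (1 / \<gamma>) *\<^sub>R (x (Suc k) - z k) = s k"
    by (simp add: algebra_simps)
  show ?thesis
    using weak_subgradient_prox_lagrangian[OF inexact[of k], of \<gamma> "z k"] unfolding eq by simp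
qed

lemma prox_objective_subgradient:
  "prox \<gamma> f (x (Suc k) + \<gamma> *\<^sub>R objective_subgradient k) = x (Suc k)"
  "gradient (moreau \<gamma> f) (x (Suc k) + \<gamma> *\<^sub>R objective_subgradient k) = objective_subgradient k"
  using prox_and_moreau_gradient[OF gamma(1) _ objective_subgradient] mu_pos by simp_all

lemma objective_subgradient_lipschitz:
  assumes "implicit_lipschitz_subgradient \<rho> f L"
  shows "norm (objective_subgradient (Suc k) - objective_subgradient k)
    \<le> L \<gamma> * norm (x (Suc (Suc k)) - x (Suc k))"
proof -
  have r: "x (Suc j) \<in> range (prox \<gamma> f)" for j
    using prox_objective_subgradient(1)[of j] by (metis rangeI)
  have v: "x (Suc j) + \<gamma> *\<^sub>R objective_subgradient j \<in> prox \<gamma> f -` {x (Suc j)}" for j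
    using prox_objective_subgradient(1)[of j] by simp
  show ?thesis
    using assms gamma r v unfolding implicit_lipschitz_subgradient_def
    by (metis prox_objective_subgradient(2))
qed

lemma objective_subgradient_bounded:
  assumes "implicit_bounded_subgradient \<rho> f L"
  shows "norm (objective_subgradient k) \<le> L \<gamma>"
proof -
  have "x (Suc k) \<in> range (prox \<gamma> f)"
    using prox_objective_subgradient(1)[of k] by (metis rangeI)
  moreover have "x (Suc k) + \<gamma> *\<^sub>R objective_subgradient k \<in> prox \<gamma> f -` {x (Suc k)}"
    using prox_objective_subgradient(1)[of k] by simp
  ultimately show ?thesis
    using assms gamma unfolding implicit_bounded_subgradient_def
    by (metis prox_objective_subgradient(2))
qed

text \<open>
  The four changes in one step: the primal drop by strong convexity, the drop from moving the
  centre \<open>z\<close>, and the increases caused by the new multiplier and the new penalty parameter. The last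
  two combine to \<open>(\<beta> k + \<beta> (k + 1)) / 2 * |A x (k + 1) - b|^2\<close>; the weight on the right exceeds
  this by \<open>\<kappa> / 2\<close>, and the surplus reappears on the left as a decrease of the
  infeasibility. The comparison point \<open>y\<close> is arbitrary because there is no previous primal iterate
  to compare with in the first step, where a feasible point takes its place.
\<close>

lemma descent:
  "proximal_value (Suc k) + \<kappa> / 2 * (norm (A *v x (Suc k) - b))\<^sup>2
      + \<tau> / (2 * \<gamma>) * (norm (z (Suc k) - z k))\<^sup>2 + \<mu> / 2 * (norm (y - x (Suc k)))\<^sup>2
    \<le> prox_lagrangian f A b \<gamma> (\<beta> k) y (z k) (lam k) + eps k * norm (y - x (Suc k))
      + (\<beta> k + \<beta> (Suc k) + \<kappa>) / (2 * (\<beta> k)\<^sup>2) * (norm (lam (Suc k) - lam k))\<^sup>2"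
proof -
  let ?r = "A *v x (Suc k) - b" and ?u = "x (Suc k) - z k"
  have "\<bar>s k \<bullet> (y - x (Suc k))\<bar> \<le> norm (s k) * norm (y - x (Suc k))"
    by (rule Cauchy_Schwarz_ineq2)
  also have "\<dots> \<le> eps k * norm (y - x (Suc k))"
    by (intro mult_right_mono residual) simp
  finally have primal: "prox_lagrangian f A b \<gamma> (\<beta> k) (x (Suc k)) (z k) (lam k)
        + \<mu> / 2 * (norm (y - x (Suc k)))\<^sup>2
      \<le> prox_lagrangian f A b \<gamma> (\<beta> k) y (z k) (lam k) + eps k * norm (y - x (Suc k))"
    using weak_subgradientD[OF prox_lagrangian_subgradient, of k y]
    by (simp add: left_diff_distrib diff_divide_distrib)
  have z': "z (Suc k) - z k = \<eta> *\<^sub>R ?u" "x (Suc k) - z (Suc k) = (1 - \<eta>) *\<^sub>R ?u"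
    by (simp_all add: z_step algebra_simps)
  have center: "1 / (2 * \<gamma>) * (norm (x (Suc k) - z (Suc k)))\<^sup>2
      = 1 / (2 * \<gamma>) * (norm ?u)\<^sup>2 - \<tau> / (2 * \<gamma>) * (norm (z (Suc k) - z k))\<^sup>2"
    unfolding z' norm_scaleR power_mult_distrib power2_abs using eta gamma
    by (simp add: power2_eq_square field_simps)
  have l: "lam (Suc k) - lam k = \<beta> k *\<^sub>R ?r"
    by (simp add: lam_step)
  have dual: "(\<beta> k + \<beta> (Suc k) + \<kappa>) / (2 * (\<beta> k)\<^sup>2) * (norm (lam (Suc k) - lam k))\<^sup>2
      = (\<beta> k + \<beta> (Suc k) + \<kappa>) / 2 * (norm ?r)\<^sup>2"
    unfolding l using beta[of k] by (simp add: power_mult_distrib)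
  have "lam (Suc k) \<bullet> ?r = lam k \<bullet> ?r + \<beta> k * (norm ?r)\<^sup>2"
    by (simp add: lam_step inner_add_left power2_norm_eq_inner)
  then have "proximal_value (Suc k) = prox_lagrangian f A b \<gamma> (\<beta> k) (x (Suc k)) (z k) (lam k)
      - \<tau> / (2 * \<gamma>) * (norm (z (Suc k) - z k))\<^sup>2 + (\<beta> k + \<beta> (Suc k)) / 2 * (norm ?r)\<^sup>2"
    unfolding proximal_value_def prox_lagrangian_def aug_lagrangian_def center
    by (simp add: add_divide_distrib distrib_right)
  with primal show ?thesis
    unfolding dual by (simp add: add_divide_distrib distrib_right)
qed

text \<open>
  The multiplier increment is a multiple of \<open>A x - b\<close> and lies in the range of \<open>A\<close>, since \<open>b\<close>
  does. The weight of the energy is defined so that the eigenvalue bound gives exactly this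
  estimate. If \<open>A = 0\<close>, there is no positive eigenvalue and the weight may be any real number, but
  then the increment vanishes; taking the positive part of the weight covers both cases.
\<close>

lemma dual_step_bound:
  "(\<beta> k + \<beta> (Suc k) + \<kappa>) / (2 * (\<beta> k)\<^sup>2) * (norm (lam (Suc k) - lam k))\<^sup>2
    \<le> max 0 (imeal_alpha \<gamma> \<eta> A \<beta> k) * (\<gamma> * norm ((lam (Suc k) - lam k) v* A))\<^sup>2"
proof (cases "A = 0")
  case True
  then have "lam (Suc k) - lam k = 0"
    using feasible by (auto simp: lam_step)
  then show ?thesis
    by simp
next
  case False
  define v where "v = lam (Suc k) - lam k"
  define \<sigma> where "\<sigma> = min_pos_eigenvalue (transpose A ** A)"
  have sigma: "0 < \<sigma>"
    unfolding \<sigma>_def by (rule min_pos_eigenvalue_gram[OF False])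
  obtain p where p: "b = A *v p"
    using feasible by auto
  have "v = A *v (\<beta> k *\<^sub>R (x (Suc k) - p))"
    by (simp add: v_def lam_step p algebra_simps)
  then have le: "\<sigma> * (norm v)\<^sup>2 \<le> (norm (v v* A))\<^sup>2"
    unfolding \<sigma>_def by (intro min_pos_eigenvalue_gram[OF False]) simp
  have alpha: "imeal_alpha \<gamma> \<eta> A \<beta> k = (\<beta> k + \<beta> (Suc k) + \<kappa>) / (2 * (\<beta> k)\<^sup>2) / (\<gamma>\<^sup>2 * \<sigma>)"
    by (simp add: imeal_alpha_def c_const_def \<sigma>_def mult_ac)
  have pos: "0 < (\<beta> k + \<beta> (Suc k) + \<kappa>) / (2 * (\<beta> k)\<^sup>2)"
    using beta[of k] beta[of "Suc k"] kappa_pos by (intro divide_pos_pos add_pos_pos) auto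
  have alpha_pos: "0 < imeal_alpha \<gamma> \<eta> A \<beta> k"
    unfolding alpha using gamma sigma by (intro divide_pos_pos pos) auto
  have "(\<beta> k + \<beta> (Suc k) + \<kappa>) / (2 * (\<beta> k)\<^sup>2) * (norm v)\<^sup>2
      = imeal_alpha \<gamma> \<eta> A \<beta> k * (\<gamma>\<^sup>2 * (\<sigma> * (norm v)\<^sup>2))"
    unfolding alpha using gamma sigma by simp
  also have "\<dots> \<le> imeal_alpha \<gamma> \<eta> A \<beta> k * (\<gamma>\<^sup>2 * (norm (v v* A))\<^sup>2)"
    using le alpha_pos by (intro mult_left_mono) auto
  also have "\<dots> \<le> max 0 (imeal_alpha \<gamma> \<eta> A \<beta> k) * (\<gamma>\<^sup>2 * (norm (v v* A))\<^sup>2)"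
    by (intro mult_right_mono) auto
  finally show ?thesis
    by (simp add: v_def power_mult_distrib)
qed

text \<open>
  Subtract the dual equations of two consecutive steps; each source of change is kept separate,
  since each is paid for differently.
\<close>

lemma dual_increment:
  "\<gamma> * norm ((lam (Suc (Suc k)) - lam (Suc k)) v* A)
    \<le> \<gamma> * (eps (Suc k) + eps k) + norm (z (Suc k) - z k) + norm (x (Suc (Suc k)) - x (Suc k))
      + \<gamma> * norm (objective_subgradient (Suc k) - objective_subgradient k)"
proof -
  have lA: "lam (Suc j) v* A = s j + (1 / \<gamma>) *\<^sub>R (z j - x (Suc j)) - objective_subgradient j" for j
    by (simp add: objective_subgradient_def)
  have lin: "(lam (Suc (Suc k)) - lam (Suc k)) v* A = lam (Suc (Suc k)) v* A - lam (Suc k) v* A"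
    using matrix_vector_mult_diff_distrib[of "transpose A"] by simp
  have "\<gamma> *\<^sub>R ((lam (Suc (Suc k)) - lam (Suc k)) v* A)
      = \<gamma> *\<^sub>R (s (Suc k) - s k) + (z (Suc k) - z k) - (x (Suc (Suc k)) - x (Suc k))
        - \<gamma> *\<^sub>R (objective_subgradient (Suc k) - objective_subgradient k)"
    unfolding lin lA using gamma by (simp add: algebra_simps)
  then have "\<gamma> * norm ((lam (Suc (Suc k)) - lam (Suc k)) v* A)
      = norm (\<gamma> *\<^sub>R (s (Suc k) - s k) + (z (Suc k) - z k) - (x (Suc (Suc k)) - x (Suc k))
        - \<gamma> *\<^sub>R (objective_subgradient (Suc k) - objective_subgradient k))"
    using gamma by (metis abs_of_pos norm_scaleR)
  also have "\<dots> \<le> norm (\<gamma> *\<^sub>R (s (Suc k) - s k)) + norm (z (Suc k) - z k)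
      + norm (x (Suc (Suc k)) - x (Suc k))
      + norm (\<gamma> *\<^sub>R (objective_subgradient (Suc k) - objective_subgradient k))"
    by (intro order_trans[OF norm_triangle_ineq4] add_right_mono norm_triangle_ineq)
  also have "norm (\<gamma> *\<^sub>R (s (Suc k) - s k)) \<le> \<gamma> * (eps (Suc k) + eps k)"
    using gamma norm_triangle_le_diff[OF add_mono[OF residual[of "Suc k"] residual[of k]]] by simp
  finally show ?thesis
    using gamma by simp
qed

lemma envelope_gradient_exact_minimizer:
  obtains y where "envelope_gradient k = ((1 / \<gamma>) *\<^sub>R (z k - y), A *v y - b)"
    and "norm (y - x (Suc k)) \<le> 2 / \<mu> * eps k"
proof -
  have "weakly_convex (- \<mu>) (\<lambda>y. prox_lagrangian f A b \<gamma> (\<beta> k) y (z k) (lam k))"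
    using weakly_convex_prox_lagrangian[OF wc less_imp_le[OF beta]] by simp
  from strongly_convex_minimizer[OF mu_pos this prox_lagrangian_subgradient]
  obtain y where y: "weak_subgradient (- \<mu>) (\<lambda>y. prox_lagrangian f A b \<gamma> (\<beta> k) y (z k) (lam k)) y 0"
    and n: "norm (y - x (Suc k)) \<le> 2 / \<mu> * norm (s k)"
    by blast
  have "2 / \<mu> * norm (s k) \<le> 2 / \<mu> * eps k"
    using mu_pos residual by (intro mult_left_mono) auto
  with n meal_envelope_gradient[OF gamma(1) mu_pos y] show ?thesis
    by (intro that) (auto simp: envelope_gradient_def)
qed

text \<open>
  The exact minimizer \<open>y\<close> is replaced by the iterate \<open>x (k + 1)\<close>; their distance, of order
  \<open>eps k\<close>, enters both components. The first component at \<open>x (k + 1)\<close> is the increment of \<open>z\<close> divided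
  by \<open>\<gamma> \<eta>\<close>.
\<close>

lemma envelope_gradient_bound:
  "(norm (envelope_gradient k))\<^sup>2
    \<le> 2 / (\<gamma> * \<eta>)\<^sup>2 * (norm (z (Suc k) - z k))\<^sup>2 + 2 * (norm (A *v x (Suc k) - b))\<^sup>2
      + 8 * (1 / \<gamma>\<^sup>2 + (onorm ((*v) A))\<^sup>2) / \<mu>\<^sup>2 * (eps k)\<^sup>2"
proof -
  obtain y where grad: "envelope_gradient k = ((1 / \<gamma>) *\<^sub>R (z k - y), A *v y - b)"
    and near: "norm (y - x (Suc k)) \<le> 2 / \<mu> * eps k"
    by (rule envelope_gradient_exact_minimizer)
  let ?d = "norm (y - x (Suc k))"
  have "norm (z k - y) \<le> norm (x (Suc k) - z k) + ?d"
    using norm_triangle_ineq[of "x (Suc k) - z k" "y - x (Suc k)"] by (simp add: norm_minus_commute)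
  moreover have "norm (z (Suc k) - z k) = \<eta> * norm (x (Suc k) - z k)"
    using eta by (simp add: z_step norm_minus_commute)
  moreover have "norm ((1 / \<gamma>) *\<^sub>R (z k - y)) = 1 / \<gamma> * norm (z k - y)"
    using gamma by simp
  ultimately have "norm ((1 / \<gamma>) *\<^sub>R (z k - y))
      \<le> 1 / (\<gamma> * \<eta>) * norm (z (Suc k) - z k) + 1 / \<gamma> * ?d"
    using gamma eta by (simp add: field_simps)
  from power_mono[OF this norm_ge_zero, of 2]
  have first: "(norm ((1 / \<gamma>) *\<^sub>R (z k - y)))\<^sup>2
      \<le> 2 / (\<gamma> * \<eta>)\<^sup>2 * (norm (z (Suc k) - z k))\<^sup>2 + 2 / \<gamma>\<^sup>2 * ?d\<^sup>2"
    using power2_le_add2[of "1 / (\<gamma> * \<eta>) * norm (z (Suc k) - z k)" "1 / \<gamma> * ?d"]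
    by (simp add: power_mult_distrib power_divide)
  have "A *v y - b = (A *v x (Suc k) - b) + A *v (y - x (Suc k))"
    by (simp add: algebra_simps)
  then have "norm (A *v y - b) \<le> norm (A *v x (Suc k) - b) + norm (A *v (y - x (Suc k)))"
    by (metis norm_triangle_ineq)
  also have "\<dots> \<le> norm (A *v x (Suc k) - b) + onorm ((*v) A) * ?d"
    by (intro add_left_mono onorm) simp
  finally have "norm (A *v y - b) \<le> norm (A *v x (Suc k) - b) + onorm ((*v) A) * ?d" .
  from power_mono[OF this norm_ge_zero, of 2]
  have second: "(norm (A *v y - b))\<^sup>2
      \<le> 2 * (norm (A *v x (Suc k) - b))\<^sup>2 + 2 * (onorm ((*v) A))\<^sup>2 * ?d\<^sup>2"
    using power2_le_add2[of "norm (A *v x (Suc k) - b)" "onorm ((*v) A) * ?d"]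
    by (simp add: power_mult_distrib)
  have "?d\<^sup>2 \<le> (2 / \<mu> * eps k)\<^sup>2"
    by (intro power_mono near) simp
  then have "2 * (1 / \<gamma>\<^sup>2 + (onorm ((*v) A))\<^sup>2) * ?d\<^sup>2
      \<le> 2 * (1 / \<gamma>\<^sup>2 + (onorm ((*v) A))\<^sup>2) * (2 / \<mu> * eps k)\<^sup>2"
    by (intro mult_left_mono) auto
  also have "\<dots> = 8 * (1 / \<gamma>\<^sup>2 + (onorm ((*v) A))\<^sup>2) / \<mu>\<^sup>2 * (eps k)\<^sup>2"
    by (simp add: power_mult_distrib power_divide)
  finally have third: "2 / \<gamma>\<^sup>2 * ?d\<^sup>2 + 2 * (onorm ((*v) A))\<^sup>2 * ?d\<^sup>2
      \<le> 8 * (1 / \<gamma>\<^sup>2 + (onorm ((*v) A))\<^sup>2) / \<mu>\<^sup>2 * (eps k)\<^sup>2"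
    by (simp add: distrib_left distrib_right)
  have "(norm (envelope_gradient k))\<^sup>2 = (norm ((1 / \<gamma>) *\<^sub>R (z k - y)))\<^sup>2 + (norm (A *v y - b))\<^sup>2"
    unfolding grad by (simp add: norm_Pair)
  with first second third show ?thesis
    by linarith
qed

end

section \<open>Decrease of the energy\<close>

context imeal_run
begin

text \<open>
  Of the three contributions to the multiplier increment, the primal one is paid for by the primal
  drop. What is left of that drop, with coefficient \<open>\<theta>\<close>, absorbs the error \<open>eps * |x (k + 2) - x (k + 1)|\<close>.
  The contribution of the previous increment of \<open>z\<close> is the energy term at the earlier step, and half
  of the drop from moving the centre pays for the energy term at the later one.
\<close>

lemma lipschitz_energy_descent:
  assumes lip: "implicit_lipschitz_subgradient \<rho> f L"
    and alpha: "max 0 (imeal_alpha \<gamma> \<eta> A \<beta> (Suc k)) = a"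
    and split: "3 * a * (1 + \<gamma> * L \<gamma>)\<^sup>2 + \<theta> = \<mu> / 2" "0 < \<theta>"
    and center: "3 * a \<le> \<tau> / (4 * \<gamma>)"
  shows "proximal_value (Suc (Suc k)) + 3 * a * (norm (z (Suc (Suc k)) - z (Suc k)))\<^sup>2
      + (\<kappa> / 2 * (norm (A *v x (Suc (Suc k)) - b))\<^sup>2
         + \<tau> / (4 * \<gamma>) * (norm (z (Suc (Suc k)) - z (Suc k)))\<^sup>2)
    \<le> proximal_value (Suc k) + 3 * a * (norm (z (Suc k) - z k))\<^sup>2
      + ((eps (Suc k))\<^sup>2 / (4 * \<theta>) + 6 * a * \<gamma>\<^sup>2 * ((eps (Suc k))\<^sup>2 + (eps k)\<^sup>2))"
proof -
  let ?dx = "norm (x (Suc (Suc k)) - x (Suc k))" and ?dz = "norm (z (Suc k) - z k)"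
    and ?dz' = "norm (z (Suc (Suc k)) - z (Suc k))"
    and ?D = "\<gamma> * norm ((lam (Suc (Suc k)) - lam (Suc k)) v* A)"
    and ?e = "eps (Suc k) + eps k"
  have a: "0 \<le> a"
    using alpha by auto
  have "\<gamma> * norm (objective_subgradient (Suc k) - objective_subgradient k) \<le> \<gamma> * (L \<gamma> * ?dx)"
    using gamma by (intro mult_left_mono objective_subgradient_lipschitz lip) auto
  with dual_increment[of k] have "?D \<le> \<gamma> * ?e + ?dz + (1 + \<gamma> * L \<gamma>) * ?dx"
    by (simp add: algebra_simps)
  then have "?D\<^sup>2 \<le> 3 * (\<gamma> * ?e)\<^sup>2 + 3 * ?dz\<^sup>2 + 3 * ((1 + \<gamma> * L \<gamma>) * ?dx)\<^sup>2"
    using gamma by (intro power2_le_add3) auto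
  then have "a * ?D\<^sup>2 \<le> a * (3 * (\<gamma> * ?e)\<^sup>2 + 3 * ?dz\<^sup>2 + 3 * ((1 + \<gamma> * L \<gamma>) * ?dx)\<^sup>2)"
    by (rule mult_left_mono) (rule a)
  also have "\<dots> = 3 * a * \<gamma>\<^sup>2 * ?e\<^sup>2 + 3 * a * ?dz\<^sup>2 + 3 * a * (1 + \<gamma> * L \<gamma>)\<^sup>2 * ?dx\<^sup>2"
    unfolding power_mult_distrib by (simp add: distrib_left)
  also have "3 * a * (1 + \<gamma> * L \<gamma>)\<^sup>2 = \<mu> / 2 - \<theta>"
    using split(1) by linarith
  also have "3 * a * \<gamma>\<^sup>2 * ?e\<^sup>2 \<le> 3 * a * \<gamma>\<^sup>2 * (2 * (eps (Suc k))\<^sup>2 + 2 * (eps k)\<^sup>2)"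
    using a by (intro mult_left_mono power2_le_add2) auto
  finally have dual: "a * ?D\<^sup>2 \<le> 6 * a * \<gamma>\<^sup>2 * ((eps (Suc k))\<^sup>2 + (eps k)\<^sup>2)
      + 3 * a * ?dz\<^sup>2 + (\<mu> / 2 * ?dx\<^sup>2 - \<theta> * ?dx\<^sup>2)"
    by (simp add: algebra_simps)
  have center': "3 * a * ?dz'\<^sup>2 \<le> \<tau> / (4 * \<gamma>) * ?dz'\<^sup>2"
    by (intro mult_right_mono center) simp
  have half: "\<tau> / (2 * \<gamma>) * ?dz'\<^sup>2 = \<tau> / (4 * \<gamma>) * ?dz'\<^sup>2 + \<tau> / (4 * \<gamma>) * ?dz'\<^sup>2"
    using gamma by (simp add: field_simps)
  note step = descent[of "Suc k" "x (Suc k)", folded proximal_value_def,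
      unfolded norm_minus_commute[of "x (Suc k)"]]
  have combine: "P' + u + (r + q) \<le> P + v + (e1 + e2)"
    if "P' + r + q2 + m \<le> P + ed + W" "W \<le> D" "D \<le> e2 + v + (m - t)" "ed \<le> t + e1"
      "u \<le> q" "q2 = q + q" for P P' u v r q q2 m ed W D t e1 e2 :: real
    using that by linarith
  show ?thesis
    by (rule combine[OF step dual_step_bound[of "Suc k", unfolded alpha] dual
          mult_le_square_add[OF split(2)] center' half])
qed

text \<open>
  Here the subgradient difference cannot be paid for by a decrease. It contributes the term
  \<open>16 a (\<gamma> L)^2\<close> at every step, which is harmless only because \<open>a\<close> is taken of order \<open>1 / K\<close>.
\<close>

lemma bounded_energy_descent:
  assumes bounded: "implicit_bounded_subgradient \<rho> f L"
    and alpha: "imeal_alpha \<gamma> \<eta> A \<beta> (Suc k) = a" "0 \<le> a"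
    and primal: "4 * a \<le> \<mu> / 4"
    and center: "4 * a \<le> \<tau> / (4 * \<gamma>)"
  shows "proximal_value (Suc (Suc k)) + 4 * a * (norm (z (Suc (Suc k)) - z (Suc k)))\<^sup>2
      + (\<kappa> / 2 * (norm (A *v x (Suc (Suc k)) - b))\<^sup>2
         + \<tau> / (4 * \<gamma>) * (norm (z (Suc (Suc k)) - z (Suc k)))\<^sup>2)
    \<le> proximal_value (Suc k) + 4 * a * (norm (z (Suc k) - z k))\<^sup>2
      + ((eps (Suc k))\<^sup>2 / \<mu> + 16 * a * (\<gamma> * L \<gamma>)\<^sup>2
         + 8 * a * \<gamma>\<^sup>2 * ((eps (Suc k))\<^sup>2 + (eps k)\<^sup>2))"
proof -
  let ?dx = "norm (x (Suc (Suc k)) - x (Suc k))" and ?dz = "norm (z (Suc k) - z k)"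
    and ?dz' = "norm (z (Suc (Suc k)) - z (Suc k))"
    and ?D = "\<gamma> * norm ((lam (Suc (Suc k)) - lam (Suc k)) v* A)"
    and ?e = "eps (Suc k) + eps k"
  have "norm (objective_subgradient (Suc k) - objective_subgradient k) \<le> L \<gamma> + L \<gamma>"
    by (intro norm_triangle_le_diff add_mono objective_subgradient_bounded bounded)
  then have "\<gamma> * norm (objective_subgradient (Suc k) - objective_subgradient k) \<le> \<gamma> * (L \<gamma> + L \<gamma>)"
    using gamma by (intro mult_left_mono) auto
  also have "\<dots> = 2 * (\<gamma> * L \<gamma>)"
    by simp
  finally have "\<gamma> * norm (objective_subgradient (Suc k) - objective_subgradient k) \<le> 2 * (\<gamma> * L \<gamma>)" .
  with dual_increment[of k] have "?D \<le> \<gamma> * ?e + ?dz + ?dx + 2 * (\<gamma> * L \<gamma>)"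
    by linarith
  then have "?D\<^sup>2 \<le> 4 * (\<gamma> * ?e)\<^sup>2 + 4 * ?dz\<^sup>2 + 4 * ?dx\<^sup>2 + 4 * (2 * (\<gamma> * L \<gamma>))\<^sup>2"
    using gamma by (intro power2_le_add4) auto
  then have "a * ?D\<^sup>2 \<le> a * (4 * (\<gamma> * ?e)\<^sup>2 + 4 * ?dz\<^sup>2 + 4 * ?dx\<^sup>2 + 4 * (2 * (\<gamma> * L \<gamma>))\<^sup>2)"
    by (rule mult_left_mono) (rule alpha)
  also have "\<dots> = 4 * a * \<gamma>\<^sup>2 * ?e\<^sup>2 + 4 * a * ?dz\<^sup>2 + 4 * a * ?dx\<^sup>2 + 16 * a * (\<gamma> * L \<gamma>)\<^sup>2"
    unfolding power_mult_distrib by (simp add: distrib_left)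
  also have "4 * a * ?dx\<^sup>2 \<le> \<mu> / 4 * ?dx\<^sup>2"
    by (intro mult_right_mono primal) simp
  also have "4 * a * \<gamma>\<^sup>2 * ?e\<^sup>2 \<le> 4 * a * \<gamma>\<^sup>2 * (2 * (eps (Suc k))\<^sup>2 + 2 * (eps k)\<^sup>2)"
    using alpha by (intro mult_left_mono power2_le_add2) auto
  also have "\<dots> = 8 * a * \<gamma>\<^sup>2 * ((eps (Suc k))\<^sup>2 + (eps k)\<^sup>2)"
    by (simp add: algebra_simps)
  finally have dual: "a * ?D\<^sup>2 \<le> 8 * a * \<gamma>\<^sup>2 * ((eps (Suc k))\<^sup>2 + (eps k)\<^sup>2)
      + 4 * a * ?dz\<^sup>2 + \<mu> / 4 * ?dx\<^sup>2 + 16 * a * (\<gamma> * L \<gamma>)\<^sup>2"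
    by simp
  have center': "4 * a * ?dz'\<^sup>2 \<le> \<tau> / (4 * \<gamma>) * ?dz'\<^sup>2"
    by (intro mult_right_mono center) simp
  have half: "\<tau> / (2 * \<gamma>) * ?dz'\<^sup>2 = \<tau> / (4 * \<gamma>) * ?dz'\<^sup>2 + \<tau> / (4 * \<gamma>) * ?dz'\<^sup>2"
    using gamma by (simp add: field_simps)
  note step = descent[of "Suc k" "x (Suc k)", folded proximal_value_def,
      unfolded norm_minus_commute[of "x (Suc k)"]]
  have "4 * (t / 4) = t" for t :: real
    by simp
  then have primal_error: "eps (Suc k) * ?dx \<le> \<mu> / 4 * ?dx\<^sup>2 + (eps (Suc k))\<^sup>2 / \<mu>"
    using mult_le_square_add[of "\<mu> / 4" "eps (Suc k)" ?dx] divide_pos_pos[OF mu_pos, of 4]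
    by (metis zero_less_numeral)
  have quarter: "\<mu> / 2 * ?dx\<^sup>2 = \<mu> / 4 * ?dx\<^sup>2 + \<mu> / 4 * ?dx\<^sup>2"
    by (simp add: field_simps)
  have dual_step: "(\<beta> (Suc k) + \<beta> (Suc (Suc k)) + \<kappa>) / (2 * (\<beta> (Suc k))\<^sup>2)
      * (norm (lam (Suc (Suc k)) - lam (Suc k)))\<^sup>2 \<le> a * ?D\<^sup>2"
    using dual_step_bound[of "Suc k"] alpha by simp
  have combine: "P' + u + (r + q) \<le> P + v + (e1 + e3 + e2)"
    if "P' + r + q2 + m2 \<le> P + ed + W" "W \<le> D" "D \<le> e2 + v + m + e3" "ed \<le> m + e1"
      "u \<le> q" "q2 = q + q" "m2 = m + m" for P P' u v r q q2 m m2 ed W D e1 e2 e3 :: real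
    using that by linarith
  show ?thesis
    by (rule combine[OF step dual_step dual primal_error center' half quarter])
qed

text \<open>
  Rewrites the gradient bound in terms of the combination of squares that the energy loses in a step.
\<close>

lemma envelope_gradient_le_decrease:
  "(norm (envelope_gradient k))\<^sup>2
    \<le> (8 / (\<gamma> * \<eta>\<^sup>2 * \<tau>) + 4 / \<kappa>)
        * (\<kappa> / 2 * (norm (A *v x (Suc k) - b))\<^sup>2 + \<tau> / (4 * \<gamma>) * (norm (z (Suc k) - z k))\<^sup>2)
      + 8 * (1 / \<gamma>\<^sup>2 + (onorm ((*v) A))\<^sup>2) / \<mu>\<^sup>2 * (eps k)\<^sup>2"
proof -
  let ?p = "\<kappa> / 2 * (norm (A *v x (Suc k) - b))\<^sup>2"
    and ?q = "\<tau> / (4 * \<gamma>) * (norm (z (Suc k) - z k))\<^sup>2"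
  have pos: "0 < \<gamma>" "0 < \<eta>" "0 < \<tau>" "0 < \<kappa>"
    using gamma eta tau_pos kappa_pos by auto
  have coeff: "8 / (\<gamma> * \<eta>\<^sup>2 * t) * (t / (4 * \<gamma>)) = 2 / (\<gamma> * \<eta>)\<^sup>2" if "0 < t" for t
    using that pos(1,2) by (simp add: power_mult_distrib power2_eq_square)
  have "2 / (\<gamma> * \<eta>)\<^sup>2 * (norm (z (Suc k) - z k))\<^sup>2 = 8 / (\<gamma> * \<eta>\<^sup>2 * \<tau>) * ?q"
    unfolding coeff[OF pos(3), symmetric] by (simp only: mult.assoc)
  moreover have coeff': "4 / t * (t / 2) = 2" if "0 < t" for t :: real
    using that by simp
  have "2 * (norm (A *v x (Suc k) - b))\<^sup>2 = 4 / \<kappa> * ?p"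
    using coeff'[OF pos(4)] by (metis mult.assoc)
  moreover have "0 \<le> 8 / (\<gamma> * \<eta>\<^sup>2 * \<tau>) * ?p" "0 \<le> 4 / \<kappa> * ?q"
    using pos by (intro mult_nonneg_nonneg divide_nonneg_nonneg; simp)+
  ultimately show ?thesis
    using envelope_gradient_bound[of k] unfolding distrib_left distrib_right by linarith
qed

text \<open>
  With \<open>a = max 0 \<alpha>\<close> instead of \<open>\<alpha>\<close> the energy only grows, so the assumed lower bound is
  inherited. The strict inequality for \<open>\<alpha>\<close> leaves a positive coefficient \<open>\<theta>\<close> for absorbing the errors,
  and the energy is decreasing up to a summable error.
\<close>

lemma summable_envelope_gradient:
  assumes lip: "implicit_lipschitz_subgradient \<rho> f L"
    and alpha: "\<And>k. imeal_alpha \<gamma> \<eta> A \<beta> k = \<alpha>"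
    and primal: "\<alpha> < (1 - \<gamma> * \<rho>) / (6 * \<gamma> * (1 + \<gamma> * L \<gamma>)\<^sup>2)"
    and center: "\<alpha> < 1 / (12 * \<gamma>) * \<tau>"
    and low: "\<And>k. 1 \<le> k \<Longrightarrow> E_low \<le> imeal_energy 3 f A b \<gamma> \<eta> \<beta> x z lam k"
    and eps_sq: "summable (\<lambda>k. (eps k)\<^sup>2)"
  shows "summable (\<lambda>k. (norm (envelope_gradient k))\<^sup>2)"
proof -
  define a where "a = max 0 \<alpha>"
  define l where "l = 1 + \<gamma> * L \<gamma>"
  define \<theta> where "\<theta> = \<mu> / 2 - 3 * a * l\<^sup>2"
  define E where "E k = proximal_value (Suc k) + 3 * a * (norm (z (Suc k) - z k))\<^sup>2" for k
  define g where "g k = \<kappa> / 2 * (norm (A *v x (Suc k) - b))\<^sup>2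
      + \<tau> / (4 * \<gamma>) * (norm (z (Suc k) - z k))\<^sup>2" for k
  define e where "e k = (eps (Suc k))\<^sup>2 / (4 * \<theta>) + 6 * a * \<gamma>\<^sup>2 * ((eps (Suc k))\<^sup>2 + (eps k)\<^sup>2)" for k
  have a: "0 \<le> a"
    by (simp add: a_def)
  have "0 < L \<gamma>"
    using lip gamma by (simp add: implicit_lipschitz_subgradient_def)
  then have l: "0 < l"
    using gamma by (simp add: l_def add_pos_pos)
  have gr: "0 < 1 - \<gamma> * \<rho>"
    using mu_pos gamma by (simp add: field_simps)
  have "a < (1 - \<gamma> * \<rho>) / (6 * \<gamma> * l\<^sup>2)"
    using primal gr gamma l by (simp add: a_def l_def)
  then have "3 * a * l\<^sup>2 < \<mu> / 2"
    using gamma l by (simp add: field_simps)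
  then have theta: "0 < \<theta>"
    by (simp add: \<theta>_def)
  have "\<alpha> * 3 \<le> \<tau> / (4 * \<gamma>)"
    using center gamma by (simp add: field_simps)
  moreover have "0 \<le> \<tau> / (4 * \<gamma>)"
    using gamma tau_pos by (intro divide_nonneg_nonneg) auto
  ultimately have center': "3 * a \<le> \<tau> / (4 * \<gamma>)"
    by (simp add: a_def max_def)
  have step: "E (Suc k) + g (Suc k) \<le> E k + e k" for k
    unfolding E_def g_def e_def
  proof (rule lipschitz_energy_descent[OF lip _ _ theta center'])
    show "3 * a * (1 + \<gamma> * L \<gamma>)\<^sup>2 + \<theta> = \<mu> / 2"
      by (simp add: \<theta>_def l_def)
  qed (simp add: alpha a_def)
  have E_low: "E_low \<le> E k" for k
  proof -
    have "3 * \<alpha> * (norm (z (Suc k) - z k))\<^sup>2 \<le> 3 * a * (norm (z (Suc k) - z k))\<^sup>2"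
      by (intro mult_right_mono) (auto simp: a_def)
    then show ?thesis
      using low[of "Suc k"] by (simp add: imeal_energy_def E_def proximal_value_def alpha)
  qed
  have e0: "0 \<le> e k" for k
    using theta a by (simp add: e_def)
  have g0: "0 \<le> g k" for k
    using kappa_pos tau_pos gamma eta unfolding g_def
    by (intro add_nonneg_nonneg mult_nonneg_nonneg divide_nonneg_nonneg) auto
  have eps_sq': "summable (\<lambda>k. (eps (Suc k))\<^sup>2)"
    using eps_sq by (simp add: summable_Suc_iff[of "\<lambda>k. (eps k)\<^sup>2"])
  have e_sum: "summable e"
    unfolding e_def by (intro summable_add summable_mult summable_divide eps_sq eps_sq')
  have "summable (\<lambda>k. g (Suc k))"
  proof (rule summableI_nonneg_bounded)
    fix n
    have "(\<Sum>k<n. g (Suc k)) \<le> E 0 - E n + (\<Sum>k<n. e k)"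
      by (rule telescoping_sum_bound[where g = "\<lambda>k. g (Suc k)", OF step])
    also have "(\<Sum>k<n. e k) \<le> suminf e"
      using e_sum e0 by (intro sum_le_suminf) auto
    finally show "(\<Sum>k<n. g (Suc k)) \<le> E 0 - E_low + suminf e"
      using E_low[of n] by linarith
  qed (rule g0)
  then have g_sum: "summable g"
    by (simp add: summable_Suc_iff)
  show ?thesis
  proof (rule summable_comparison_test')
    show "summable (\<lambda>k. (8 / (\<gamma> * \<eta>\<^sup>2 * \<tau>) + 4 / \<kappa>) * g k
        + 8 * (1 / \<gamma>\<^sup>2 + (onorm ((*v) A))\<^sup>2) / \<mu>\<^sup>2 * (eps k)\<^sup>2)"
      by (intro summable_add summable_mult g_sum eps_sq)
    show "norm ((norm (envelope_gradient k))\<^sup>2)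
        \<le> (8 / (\<gamma> * \<eta>\<^sup>2 * \<tau>) + 4 / \<kappa>) * g k
        + 8 * (1 / \<gamma>\<^sup>2 + (onorm ((*v) A))\<^sup>2) / \<mu>\<^sup>2 * (eps k)\<^sup>2" if "0 \<le> k" for k
      using envelope_gradient_le_decrease[of k] by (simp add: g_def)
  qed
qed

section \<open>Bounds on the first step that are uniform in the penalty parameters\<close>

text \<open>
  Test the dual equation at the first step with \<open>x 1 - p\<close> for a feasible point \<open>p\<close>. The penalty
  contributes \<open>\<beta> 0 * |A (x 1 - p)|^2\<close>, which has the favourable sign and can be dropped, so that the
  resulting bound is independent of \<open>\<beta> 0\<close>.
\<close>

lemma first_iterate_bound:
  assumes bounded: "implicit_bounded_subgradient \<rho> f L" and p: "A *v p = b"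
  shows "norm (x 1 - p) \<le> \<gamma> * (eps 0 + L \<gamma> + norm (lam 0 v* A)) + norm (z 0 - p)"
proof -
  define d where "d = x 1 - p"
  define w where "w = objective_subgradient 0"
  define r where "r = s 0 - w - lam 0 v* A + (1 / \<gamma>) *\<^sub>R (z 0 - p)"
  have Ad: "A *v x 1 - b = A *v d"
    by (simp add: d_def p[symmetric] matrix_vector_mult_diff_distrib)
  have l1: "lam 1 = lam 0 + \<beta> 0 *\<^sub>R (A *v d)"
    using lam_step[of 0] Ad by simp
  have "(lam 1 v* A) \<bullet> d = (lam 0 v* A) \<bullet> d + \<beta> 0 * (norm (A *v d))\<^sup>2"
    unfolding l1 by (simp add: dot_lmul_matrix inner_add_left power2_norm_eq_inner)
  moreover have "lam 1 v* A = s 0 + (1 / \<gamma>) *\<^sub>R ((z 0 - p) - d) - w"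
    by (simp add: w_def objective_subgradient_def d_def)
  then have "r = (lam 1 v* A - lam 0 v* A) + (1 / \<gamma>) *\<^sub>R d"
    by (simp add: r_def algebra_simps)
  ultimately have "r \<bullet> d = 1 / \<gamma> * (norm d)\<^sup>2 + \<beta> 0 * (norm (A *v d))\<^sup>2"
    by (simp add: inner_add_left inner_diff_left power2_norm_eq_inner)
  moreover have "0 \<le> \<beta> 0 * (norm (A *v d))\<^sup>2"
    using beta[of 0] by simp
  moreover have "r \<bullet> d \<le> norm r * norm d"
    by (rule norm_cauchy_schwarz)
  ultimately have "1 / \<gamma> * (norm d)\<^sup>2 \<le> norm r * norm d"
    by linarith
  then have "norm d * norm d \<le> (\<gamma> * norm r) * norm d"
    using gamma by (simp add: field_simps power2_eq_square)
  then have "norm d \<le> \<gamma> * norm r"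
    using gamma by (cases "d = 0") auto
  also have "\<dots> \<le> \<gamma> * (eps 0 + L \<gamma> + norm (lam 0 v* A) + norm ((1 / \<gamma>) *\<^sub>R (z 0 - p)))"
  proof (rule mult_left_mono)
    show "norm r \<le> eps 0 + L \<gamma> + norm (lam 0 v* A) + norm ((1 / \<gamma>) *\<^sub>R (z 0 - p))"
      unfolding r_def using residual[of 0] objective_subgradient_bounded[OF bounded, of 0]
    by (intro norm_triangle_le norm_triangle_le_diff add_mono) (auto simp: w_def)
  qed (use gamma in simp)
  also have "\<dots> = \<gamma> * (eps 0 + L \<gamma> + norm (lam 0 v* A)) + norm (z 0 - p)"
    using gamma by (simp add: distrib_left)
  finally show ?thesis
    by (simp add: d_def)
qed

text \<open>
  Apply the descent estimate of the first step with a feasible comparison point, at which the augmented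
  Lagrangian is \<open>f p\<close> for every multiplier and penalty. The multiplier term involves \<open>\<beta> 0\<close> and \<open>\<beta> 1\<close>, but
  the dual equation bounds \<open>A^T (lam 1 - lam 0)\<close> by quantities independent of them, because the
  subgradient of \<open>f\<close> is bounded; and the weight \<open>a\<close> of the energy turns such a bound into one for the
  multiplier term, whatever the penalties are.
\<close>

lemma initial_energy_bound:
  assumes bounded: "implicit_bounded_subgradient \<rho> f L" and p: "A *v p = b"
    and R: "\<gamma> * (eps 0 + L \<gamma> + norm (lam 0 v* A)) + norm (z 0 - p) = R"
    and alpha: "imeal_alpha \<gamma> \<eta> A \<beta> 0 = a" "imeal_alpha \<gamma> \<eta> A \<beta> 1 = a" "0 \<le> a"
    and center: "4 * a \<le> \<tau> / (4 * \<gamma>)"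
  shows "imeal_energy 4 f A b \<gamma> \<eta> \<beta> x z lam 1
    \<le> f p + 1 / (2 * \<gamma>) * (norm (p - z 0))\<^sup>2 + eps 0 * R + 4 * a * R\<^sup>2"
proof -
  have near: "norm (p - x 1) \<le> R"
    using first_iterate_bound[OF bounded p] R by (simp add: norm_minus_commute)
  have "lam 1 v* A = s 0 + (1 / \<gamma>) *\<^sub>R (z 0 - x 1) - objective_subgradient 0"
    by (simp add: objective_subgradient_def)
  moreover have "(lam 1 - lam 0) v* A = lam 1 v* A - lam 0 v* A"
    using matrix_vector_mult_diff_distrib[of "transpose A"] by simp
  ultimately have "(lam 1 - lam 0) v* A
      = s 0 - objective_subgradient 0 - lam 0 v* A + (1 / \<gamma>) *\<^sub>R (z 0 - x 1)"
    by simp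
  also have "norm \<dots> \<le> eps 0 + L \<gamma> + norm (lam 0 v* A) + norm ((1 / \<gamma>) *\<^sub>R (z 0 - x 1))"
    using residual[of 0] objective_subgradient_bounded[OF bounded, of 0]
    by (intro norm_triangle_le norm_triangle_le_diff add_mono) auto
  finally have "\<gamma> * norm ((lam 1 - lam 0) v* A)
      \<le> \<gamma> * (eps 0 + L \<gamma> + norm (lam 0 v* A) + norm ((1 / \<gamma>) *\<^sub>R (z 0 - x 1)))"
    using gamma by (intro mult_left_mono) auto
  also have "\<dots> = \<gamma> * (eps 0 + L \<gamma> + norm (lam 0 v* A)) + norm (z 0 - x 1)"
    using gamma by (simp add: distrib_left)
  also have "norm (z 0 - x 1) \<le> norm (z 0 - p) + norm (p - x 1)"
    using norm_triangle_ineq[of "z 0 - p" "p - x 1"] by simp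
  finally have "\<gamma> * norm ((lam 1 - lam 0) v* A) \<le> 2 * R"
    using near R by linarith
  then have "(\<gamma> * norm ((lam 1 - lam 0) v* A))\<^sup>2 \<le> (2 * R)\<^sup>2"
    using gamma by (intro power_mono) auto
  then have "a * (\<gamma> * norm ((lam 1 - lam 0) v* A))\<^sup>2 \<le> a * (2 * R)\<^sup>2"
    using alpha(3) by (rule mult_left_mono)
  then have dual: "(\<beta> 0 + \<beta> 1 + \<kappa>) / (2 * (\<beta> 0)\<^sup>2) * (norm (lam 1 - lam 0))\<^sup>2 \<le> 4 * a * R\<^sup>2"
    using dual_step_bound[of 0] alpha by (simp add: power_mult_distrib)
  have "eps 0 * norm (p - x 1) \<le> eps 0 * R"
    by (intro mult_left_mono near eps_nonneg)
  moreover have "0 \<le> \<mu> / 2 * (norm (p - x 1))\<^sup>2" "0 \<le> \<kappa> / 2 * (norm (A *v x 1 - b))\<^sup>2"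
    using mu_pos kappa_pos by (intro mult_nonneg_nonneg; simp)+
  moreover have "prox_lagrangian f A b \<gamma> (\<beta> 0) p (z 0) (lam 0) = f p + 1 / (2 * \<gamma>) * (norm (p - z 0))\<^sup>2"
    by (simp add: prox_lagrangian_def aug_lagrangian_def p)
  moreover have "4 * a * (norm (z 1 - z 0))\<^sup>2 \<le> \<tau> / (2 * \<gamma>) * (norm (z 1 - z 0))\<^sup>2"
  proof (rule mult_right_mono)
    have "\<tau> / (4 * \<gamma>) \<le> \<tau> / (2 * \<gamma>)"
      using gamma tau_pos by (intro divide_left_mono) auto
    then show "4 * a \<le> \<tau> / (2 * \<gamma>)"
      using center by linarith
  qed simp
  moreover have "imeal_energy 4 f A b \<gamma> \<eta> \<beta> x z lam 1
      = proximal_value 1 + 4 * a * (norm (z 1 - z 0))\<^sup>2"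
    using alpha(2) by (simp add: imeal_energy_def proximal_value_def)
  ultimately show ?thesis
    using descent[of 0 p, folded One_nat_def] dual by linarith
qed

text \<open>
  For \<open>K = 1\<close> the condition on \<open>\<alpha>\<close> can hold with equality, and then no part of the primal drop is
  left for the inexactness error. In this case the gradient at the starting point itself
  provides the bound.
\<close>

lemma envelope_gradient_initial_bound:
  assumes bounded: "implicit_bounded_subgradient \<rho> f L" and p: "A *v p = b"
    and R: "\<gamma> * (eps 0 + L \<gamma> + norm (lam 0 v* A)) + norm (z 0 - p) = R"
  shows "norm (envelope_gradient 0)
    \<le> 1 / \<gamma> * (norm (z 0 - p) + (R + 2 / \<mu> * eps 0)) + onorm ((*v) A) * (R + 2 / \<mu> * eps 0)"
proof -
  obtain y where grad: "envelope_gradient 0 = ((1 / \<gamma>) *\<^sub>R (z 0 - y), A *v y - b)"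
    and near: "norm (y - x (Suc 0)) \<le> 2 / \<mu> * eps 0"
    by (rule envelope_gradient_exact_minimizer)
  have "norm (y - p) \<le> norm (y - x 1) + norm (x 1 - p)"
    using norm_triangle_ineq[of "y - x 1" "x 1 - p"] by simp
  then have yp: "norm (y - p) \<le> R + 2 / \<mu> * eps 0"
    using near first_iterate_bound[OF bounded p] R by simp
  have "norm (z 0 - y) \<le> norm (z 0 - p) + norm (y - p)"
    using norm_triangle_ineq4[of "z 0 - p" "y - p"] by simp
  also note yp
  finally have "norm ((1 / \<gamma>) *\<^sub>R (z 0 - y)) \<le> 1 / \<gamma> * (norm (z 0 - p) + (R + 2 / \<mu> * eps 0))"
    using gamma by (simp add: divide_right_mono)
  moreover have "norm (A *v y - b) \<le> onorm ((*v) A) * (R + 2 / \<mu> * eps 0)"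
  proof -
    have "A *v y - b = A *v (y - p)"
      by (simp add: p matrix_vector_mult_diff_distrib)
    then have "norm (A *v y - b) \<le> onorm ((*v) A) * norm (y - p)"
      using onorm[of "(*v) A" "y - p"] by simp
    also have "\<dots> \<le> onorm ((*v) A) * (R + 2 / \<mu> * eps 0)"
      by (intro mult_left_mono yp onorm_pos_le) simp
    finally show ?thesis .
  qed
  ultimately show ?thesis
    unfolding grad by (rule order_trans[OF norm_Pair_le add_mono])
qed

section \<open>Rates of convergence\<close>

text \<open>
  For \<open>K \<ge> 2\<close> the energy weight \<open>\<alpha> / K\<close> is at most half of what the condition on \<open>\<alpha>\<close> permits, which
  frees a quarter of \<open>\<mu>\<close> for the errors. The constant term of the descent estimate sums to
  \<open>16 \<alpha> (\<gamma> L)^2\<close> over \<open>K\<close> steps.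
\<close>

lemma sum_envelope_gradient_bound:
  assumes bounded: "implicit_bounded_subgradient \<rho> f L"
    and alpha: "\<And>k. imeal_alpha \<gamma> \<eta> A \<beta> k = \<alpha> / real K" "0 < \<alpha>" and K: "2 \<le> K"
    and primal: "\<alpha> \<le> (1 - \<rho> * \<gamma>) / (8 * \<gamma>)"
    and center: "\<alpha> \<le> 1 / (16 * \<gamma>) * \<tau>"
    and low: "\<And>k. 1 \<le> k \<Longrightarrow> E_low \<le> imeal_energy 4 f A b \<gamma> \<eta> \<beta> x z lam k"
    and initial: "imeal_energy 4 f A b \<gamma> \<eta> \<beta> x z lam 1 \<le> E_init"
    and eps_sum: "\<And>n. (\<Sum>k<n. (eps k)\<^sup>2) \<le> S"
  shows "(\<Sum>k<K. (norm (envelope_gradient (Suc k)))\<^sup>2)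
    \<le> (8 / (\<gamma> * \<eta>\<^sup>2 * \<tau>) + 4 / \<kappa>)
        * (E_init - E_low + S / \<mu> + 16 * \<alpha> * (\<gamma> * L \<gamma>)\<^sup>2 + 16 * \<alpha> * \<gamma>\<^sup>2 * S)
      + 8 * (1 / \<gamma>\<^sup>2 + (onorm ((*v) A))\<^sup>2) / \<mu>\<^sup>2 * S"
proof -
  define a where "a = \<alpha> / real K"
  define H where "H = 8 / (\<gamma> * \<eta>\<^sup>2 * \<tau>) + 4 / \<kappa>"
  define M where "M = 8 * (1 / \<gamma>\<^sup>2 + (onorm ((*v) A))\<^sup>2) / \<mu>\<^sup>2"
  define E where "E k = proximal_value (Suc k) + 4 * a * (norm (z (Suc k) - z k))\<^sup>2" for k
  define g where "g k = \<kappa> / 2 * (norm (A *v x (Suc k) - b))\<^sup>2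
      + \<tau> / (4 * \<gamma>) * (norm (z (Suc k) - z k))\<^sup>2" for k
  define e where "e k = (eps (Suc k))\<^sup>2 / \<mu> + 16 * a * (\<gamma> * L \<gamma>)\<^sup>2
      + 8 * a * \<gamma>\<^sup>2 * ((eps (Suc k))\<^sup>2 + (eps k)\<^sup>2)" for k
  have "a \<le> \<alpha> / 2"
    unfolding a_def using alpha(2) K by (intro divide_left_mono) auto
  then have a: "0 \<le> a" "a \<le> \<alpha> / 2" "real K * a = \<alpha>"
    using alpha(2) K by (simp_all add: a_def)
  have "4 * \<alpha> \<le> \<mu> / 2"
    using primal gamma by (simp add: field_simps)
  moreover have "4 * a \<le> t / 4" if "4 * \<alpha> \<le> t / 2" for t
    using that a(2) by linarith
  ultimately have primal': "4 * a \<le> \<mu> / 4"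
    by blast
  have "4 * \<alpha> \<le> \<tau> / (4 * \<gamma>)"
    using center gamma by (simp add: field_simps)
  then have center': "4 * a \<le> \<tau> / (4 * \<gamma>)"
    using a alpha(2) by linarith
  have step: "E (Suc k) + g (Suc k) \<le> E k + e k" for k
    unfolding E_def g_def e_def
    by (rule bounded_energy_descent[OF bounded _ a(1) primal' center']) (simp add: alpha a_def)
  have energy: "E k = imeal_energy 4 f A b \<gamma> \<eta> \<beta> x z lam (Suc k)" for k
    by (simp add: E_def imeal_energy_def proximal_value_def alpha a_def)
  have tail: "(\<Sum>k<n. (eps (Suc k))\<^sup>2) \<le> S" for n
    using eps_sum[of "Suc n"] zero_le_power2[of "eps 0"]
    unfolding sum.lessThan_Suc_shift by linarith
  have S: "0 \<le> S"
    using eps_sum[of 0] by simp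
  have "(\<Sum>k<K. e k) = (\<Sum>k<K. (eps (Suc k))\<^sup>2) / \<mu> + 16 * (real K * a) * (\<gamma> * L \<gamma>)\<^sup>2
      + 8 * a * \<gamma>\<^sup>2 * ((\<Sum>k<K. (eps (Suc k))\<^sup>2) + (\<Sum>k<K. (eps k)\<^sup>2))"
    by (simp add: e_def sum.distrib flip: sum_divide_distrib sum_distrib_left)
  also have "\<dots> \<le> S / \<mu> + 16 * (real K * a) * (\<gamma> * L \<gamma>)\<^sup>2 + 8 * a * \<gamma>\<^sup>2 * (S + S)"
    using mu_pos a by (intro add_mono divide_right_mono mult_left_mono tail eps_sum) auto
  also have "8 * a * \<gamma>\<^sup>2 * (S + S) \<le> 16 * \<alpha> * \<gamma>\<^sup>2 * S"
    using mult_right_mono[of a \<alpha> "16 * \<gamma>\<^sup>2 * S"] a alpha(2) S by simp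
  finally have e_sum: "(\<Sum>k<K. e k) \<le> S / \<mu> + 16 * \<alpha> * (\<gamma> * L \<gamma>)\<^sup>2 + 16 * \<alpha> * \<gamma>\<^sup>2 * S"
    by (simp add: a(3))
  have "(\<Sum>k<K. g (Suc k)) \<le> E 0 - E K + (\<Sum>k<K. e k)"
    by (rule telescoping_sum_bound[where g = "\<lambda>k. g (Suc k)", OF step])
  then have g_sum: "(\<Sum>k<K. g (Suc k))
      \<le> E_init - E_low + S / \<mu> + 16 * \<alpha> * (\<gamma> * L \<gamma>)\<^sup>2 + 16 * \<alpha> * \<gamma>\<^sup>2 * S"
    using e_sum initial low[of "Suc K"] by (simp add: energy)
  have "(norm (envelope_gradient (Suc k)))\<^sup>2 \<le> H * g (Suc k) + M * (eps (Suc k))\<^sup>2" for k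
    using envelope_gradient_le_decrease[of "Suc k"] by (simp only: g_def H_def M_def)
  then have "(\<Sum>k<K. (norm (envelope_gradient (Suc k)))\<^sup>2)
      \<le> (\<Sum>k<K. H * g (Suc k) + M * (eps (Suc k))\<^sup>2)"
    by (intro sum_mono)
  also have "\<dots> = H * (\<Sum>k<K. g (Suc k)) + M * (\<Sum>k<K. (eps (Suc k))\<^sup>2)"
    by (simp add: sum.distrib sum_distrib_left)
  also have "\<dots> \<le> H * (E_init - E_low + S / \<mu> + 16 * \<alpha> * (\<gamma> * L \<gamma>)\<^sup>2 + 16 * \<alpha> * \<gamma>\<^sup>2 * S) + M * S"
  proof (intro add_mono mult_left_mono g_sum tail)
    have "0 < \<gamma> * \<eta>\<^sup>2 * \<tau>"
      using gamma eta tau_pos by (intro mult_pos_pos) auto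
    then show "0 \<le> H"
      unfolding H_def using kappa_pos by (intro add_nonneg_nonneg divide_nonneg_pos) auto
    show "0 \<le> M"
      by (simp add: M_def)
  qed
  finally show ?thesis
    by (simp only: H_def M_def)
qed

lemma meal_measure_eq:
  "meal_measure f A b \<gamma> \<beta> z lam = (\<lambda>k. Min ((\<lambda>t. norm (envelope_gradient t)) ` {0..k}))"
  by (simp add: meal_measure_def envelope_gradient_def fun_eq_iff)

end

lemma Min_le_of_sum_squares:
  fixes a :: "nat \<Rightarrow> real"
  assumes "\<And>k. 0 \<le> a k" "(\<Sum>k<K. (a (Suc k))\<^sup>2) \<le> C" "1 \<le> K"
  shows "Min (a ` {0..K}) \<le> sqrt C / sqrt (real K)"
proof -
  let ?m = "Min (a ` {0..K})"
  have "real K * ?m\<^sup>2 = (\<Sum>k<K. ?m\<^sup>2)"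
    by simp
  also have "\<dots> \<le> (\<Sum>k<K. (a (Suc k))\<^sup>2)"
    using assms(1) by (intro sum_mono power_mono) (auto intro!: Min_le)
  finally have "?m\<^sup>2 \<le> C / real K"
    using assms(2,3) by (simp add: field_simps)
  then have "?m \<le> sqrt (C / real K)"
    by (rule real_le_rsqrt)
  then show ?thesis
    by (simp add: real_sqrt_divide)
qed

theorem theorem2:
  fixes f :: "real^'n \<Rightarrow> real" and A :: "real^'n^'m" and b :: "real^'m"
    and \<rho> \<gamma> \<eta> :: real and eps :: "nat \<Rightarrow> real"
    and z0 :: "real^'n" and lam0 :: "real^'m"
  assumes "{x. A *v x = b} \<noteq> {}"
    and "0 < \<rho>" and "lower_semicontinuous f" and "weakly_convex \<rho> f"
    and "0 < \<gamma>" and "\<gamma> < inverse \<rho>"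
    and "0 < \<eta>" and "\<eta> < 2"
    and "\<forall>k. 0 < eps k" and "summable (\<lambda>k. (eps k)\<^sup>2)"
  shows
    "(\<forall>\<beta> L x z lam.
        0 < \<beta> \<and>
        imeal f A b \<gamma> \<eta> eps (\<lambda>_. \<beta>) x z lam \<and> z 0 = z0 \<and> lam 0 = lam0 \<and>
        (2 * \<beta> + \<gamma> * \<eta> * (1 - \<eta> / 2)) / (2 * c_const \<gamma> A * \<beta>\<^sup>2)
          < min ((1 - \<gamma> * \<rho>) / (6 * \<gamma> * (1 + \<gamma> * L \<gamma>)\<^sup>2)) (1 / (12 * \<gamma>) * (2 / \<eta> - 1)) \<and>
        implicit_lipschitz_subgradient \<rho> f L \<and>
        (\<exists>E_low. \<forall>k\<ge>1. E_low \<le> imeal_energy 3 f A b \<gamma> \<eta> (\<lambda>_. \<beta>) x z lam k)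
        \<longrightarrow> meal_measure f A b \<gamma> (\<lambda>_. \<beta>) z lam \<in> o(\<lambda>k. 1 / sqrt (real k)))
     \<and>
     (\<forall>\<alpha> L E_low.
        0 < \<alpha> \<and>
        \<alpha> \<le> min ((1 - \<rho> * \<gamma>) / (8 * \<gamma>)) (1 / (16 * \<gamma>) * (2 / \<eta> - 1)) \<and>
        implicit_bounded_subgradient \<rho> f L
        \<longrightarrow> (\<exists>c>0. \<forall>K\<ge>1. \<forall>\<beta> x z lam.
               (\<forall>k. 0 < \<beta> k) \<and> (\<forall>k. imeal_alpha \<gamma> \<eta> A \<beta> k = \<alpha> / real K) \<and>
               imeal f A b \<gamma> \<eta> eps \<beta> x z lam \<and> z 0 = z0 \<and> lam 0 = lam0 \<and>
               (\<forall>k\<ge>1. E_low \<le> imeal_energy 4 f A b \<gamma> \<eta> \<beta> x z lam k)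
               \<longrightarrow> meal_measure f A b \<gamma> \<beta> z lam K \<le> c / sqrt (real K)))"
proof (intro conjI allI impI, goal_cases)
  case (1 \<beta> L x z lam)
  then obtain E_low where beta: "0 < \<beta>"
    and run: "imeal f A b \<gamma> \<eta> eps (\<lambda>_. \<beta>) x z lam"
    and alpha: "(2 * \<beta> + \<gamma> * \<eta> * (1 - \<eta> / 2)) / (2 * c_const \<gamma> A * \<beta>\<^sup>2)
          < min ((1 - \<gamma> * \<rho>) / (6 * \<gamma> * (1 + \<gamma> * L \<gamma>)\<^sup>2)) (1 / (12 * \<gamma>) * (2 / \<eta> - 1))"
    and lip: "implicit_lipschitz_subgradient \<rho> f L"
    and low: "\<And>k. 1 \<le> k \<Longrightarrow> E_low \<le> imeal_energy 3 f A b \<gamma> \<eta> (\<lambda>_. \<beta>) x z lam k"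
    by blast
  obtain s where "imeal_run f A b \<rho> \<gamma> \<eta> eps (\<lambda>_. \<beta>) x z lam s"
    using imeal_obtain_run[OF run] assms beta by blast
  then interpret imeal_run f A b \<rho> \<gamma> \<eta> eps "\<lambda>_. \<beta>" x z lam s .
  have "imeal_alpha \<gamma> \<eta> A (\<lambda>_. \<beta>) k
      = (2 * \<beta> + \<gamma> * \<eta> * (1 - \<eta> / 2)) / (2 * c_const \<gamma> A * \<beta>\<^sup>2)" for k
    by (simp add: imeal_alpha_def)
  then have "summable (\<lambda>k. (norm (envelope_gradient k))\<^sup>2)"
    using alpha by (intro summable_envelope_gradient[OF lip _ _ _ low assms(10)]) auto
  then show ?case
    unfolding meal_measure_eq by (intro Min_square_summable_smallo) auto
next
  case (2 \<alpha> L E_low)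
  then have alpha: "0 < \<alpha>" "\<alpha> \<le> (1 - \<rho> * \<gamma>) / (8 * \<gamma>)" "\<alpha> \<le> 1 / (16 * \<gamma>) * (2 / \<eta> - 1)"
    and bounded: "implicit_bounded_subgradient \<rho> f L"
    by auto
  obtain p where p: "A *v p = b"
    using assms(1) by auto
  (* these constants are built from the data and the starting point alone, so one choice serves
     all K, all penalty sequences and all runs *)
  define R where "R = \<gamma> * (eps 0 + L \<gamma> + norm (lam0 v* A)) + norm (z0 - p)"
  define S where "S = (\<Sum>k. (eps k)\<^sup>2)"
  define E_init where "E_init = f p + 1 / (2 * \<gamma>) * (norm (p - z0))\<^sup>2 + eps 0 * R + 4 * \<alpha> * R\<^sup>2"
  define \<mu> where "\<mu> = 1 / \<gamma> - \<rho>"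
  define C where "C = (8 / (\<gamma> * \<eta>\<^sup>2 * (2 / \<eta> - 1)) + 4 / (\<gamma> * \<eta> * (1 - \<eta> / 2)))
        * (E_init - E_low + S / \<mu> + 16 * \<alpha> * (\<gamma> * L \<gamma>)\<^sup>2 + 16 * \<alpha> * \<gamma>\<^sup>2 * S)
      + 8 * (1 / \<gamma>\<^sup>2 + (onorm ((*v) A))\<^sup>2) / \<mu>\<^sup>2 * S"
  define G where "G = 1 / \<gamma> * (norm (z0 - p) + (R + 2 / \<mu> * eps 0))
      + onorm ((*v) A) * (R + 2 / \<mu> * eps 0)"
  define c where "c = sqrt \<bar>C\<bar> + \<bar>G\<bar> + 1"
  have c: "0 < c" "G \<le> c" "sqrt C \<le> c"
  proof -
    have "sqrt C \<le> sqrt \<bar>C\<bar>" "0 \<le> sqrt \<bar>C\<bar>"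
      by simp_all
    then show "0 < c" "G \<le> c" "sqrt C \<le> c"
      unfolding c_def by linarith+
  qed
  have "meal_measure f A b \<gamma> \<beta> z lam K \<le> c / sqrt (real K)"
    if K: "1 \<le> K" and beta: "\<forall>k. 0 < \<beta> k" and a: "\<forall>k. imeal_alpha \<gamma> \<eta> A \<beta> k = \<alpha> / real K"
      and run: "imeal f A b \<gamma> \<eta> eps \<beta> x z lam" and start: "z 0 = z0" "lam 0 = lam0"
      and low: "\<forall>k\<ge>1. E_low \<le> imeal_energy 4 f A b \<gamma> \<eta> \<beta> x z lam k"
    for K \<beta> x z lam
  proof -
    obtain s where "imeal_run f A b \<rho> \<gamma> \<eta> eps \<beta> x z lam s"
      using imeal_obtain_run[OF run] assms beta by blast
    then interpret imeal_run f A b \<rho> \<gamma> \<eta> eps \<beta> x z lam s .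
    have R: "\<gamma> * (eps 0 + L \<gamma> + norm (lam 0 v* A)) + norm (z 0 - p) = R"
      by (simp add: R_def start)
    show ?thesis
      (* for K = 1 the primal drop may be used up entirely; the bound at t = 0 takes over *)
    proof (cases "K = 1")
      case True
      have "meal_measure f A b \<gamma> \<beta> z lam K \<le> norm (envelope_gradient 0)"
        unfolding meal_measure_eq by (rule Min_le) auto
      also have "\<dots> \<le> G"
        using envelope_gradient_initial_bound[OF bounded p R] by (simp add: G_def start \<mu>_def)
      finally show ?thesis
        using c True by simp
    next
      case False
      have "4 * \<alpha> \<le> (2 / \<eta> - 1) / (4 * \<gamma>)"
        using alpha(3) assms(5) by (simp add: field_simps)
      moreover have "\<alpha> / real K \<le> \<alpha> / 1"
        using K alpha(1) by (intro divide_left_mono) auto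
      ultimately have center: "4 * (\<alpha> / real K) \<le> (2 / \<eta> - 1) / (4 * \<gamma>)"
        by linarith
      have "imeal_energy 4 f A b \<gamma> \<eta> \<beta> x z lam 1
          \<le> f p + 1 / (2 * \<gamma>) * (norm (p - z 0))\<^sup>2 + eps 0 * R + 4 * (\<alpha> / real K) * R\<^sup>2"
        using alpha(1) a by (intro initial_energy_bound[OF bounded p R _ _ _ center]) auto
      also have "\<dots> \<le> E_init"
        unfolding E_init_def start using \<open>\<alpha> / real K \<le> \<alpha> / 1\<close>
        by (intro add_left_mono mult_right_mono) auto
      finally have initial: "imeal_energy 4 f A b \<gamma> \<eta> \<beta> x z lam 1 \<le> E_init" .
      have "(\<Sum>k<K. (norm (envelope_gradient (Suc k)))\<^sup>2) \<le> C"
        unfolding C_def \<mu>_def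
      proof (rule sum_envelope_gradient_bound[OF bounded _ alpha(1) _ alpha(2,3) _ initial])
        show "(\<Sum>k<n. (eps k)\<^sup>2) \<le> S" for n
          unfolding S_def by (intro sum_le_suminf assms(10)) auto
      qed (use a low K False in auto)
      then have "meal_measure f A b \<gamma> \<beta> z lam K \<le> sqrt C / sqrt (real K)"
        unfolding meal_measure_eq using K by (intro Min_le_of_sum_squares) auto
      also have "\<dots> \<le> c / sqrt (real K)"
        by (intro divide_right_mono c) simp
      finally show ?thesis .
    qed
  qed
  then show ?case
    using c(1) by blast
qed

end
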